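(* Let $n\ge 1$, $p>-1$, $k<\ell$ real numbers, $r>0$ and $u\in H^1(B_r)$. For every $\varepsilon$ with $$0<\varepsilon<\min\left(\frac12,\frac{1}{2(p+1)}\right),$$ there exists a positive constant $C$ depending only on $n$, $p$ and $\varepsilon$ such that $$(\ell-k)\int_{\{u\ge \ell\}\cap B_r}|x_n|^p\,dx\int_{\{u\le k\}\cap B_r}|x_n|^p\,dx\le C\,r^{\,n+2p+1+\frac{n(1-2\varepsilon)}{2}-\varepsilon p}\left(\int_{\{k<u<\ell\}\cap B_r}|\nabla u|^2\,dx\right)^{1/2}\left(\int_{\{k<u<\ell\}\cap B_r}|x_n|^p\,dx\right)^{\varepsilon}.$$
   Context: $B_r$ is the open ball in $\mathbb{R}^n$ of radius $r$ centered at the origin, and $x_n$ is the last coordinate of $x\in\mathbb{R}^n$. *)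

theory Defs
  imports "HOL-Analysis.Analysis"
begin

primrec C_k :: "nat \<Rightarrow> ('a::euclidean_space \<Rightarrow> real) \<Rightarrow> bool" where
  "C_k 0 f \<longleftrightarrow> continuous_on UNIV f"
| "C_k (Suc m) f \<longleftrightarrow> f differentiable_on UNIV \<and>
     (\<forall>b\<in>Basis. C_k m (\<lambda>x. frechet_derivative f (at x) b))"

text \<open>The usual space of test functions on an open set \<open>\<Omega>\<close>, each extended by zero to the whole space.\<close>

definition test_functions :: "'a::euclidean_space set \<Rightarrow> ('a \<Rightarrow> real) set" where
  "test_functions \<Omega> = {\<phi>. (\<forall>m. C_k m \<phi>) \<and>
     (\<exists>K. compact K \<and> K \<subseteq> \<Omega> \<and> (\<forall>x. x \<notin> K \<longrightarrow> \<phi> x = 0))}"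

definition L2_on :: "'a::euclidean_space set \<Rightarrow> ('a \<Rightarrow> 'b::euclidean_space) set" where
  "L2_on \<Omega> = {f. f \<in> borel_measurable (lebesgue_on \<Omega>) \<and>
     integrable (lebesgue_on \<Omega>) (\<lambda>x. (norm (f x))\<^sup>2)}"

text \<open>\<open>g\<close> is a square-integrable weak gradient of \<open>u\<close> on \<open>\<Omega>\<close>. For open \<open>\<Omega>\<close> and square-integrable
  \<open>u\<close>, it is determined up to a null subset of \<open>\<Omega>\<close>.\<close>

definition has_L2_gradient ::
    "'a::euclidean_space set \<Rightarrow> ('a \<Rightarrow> real) \<Rightarrow> ('a \<Rightarrow> 'a) \<Rightarrow> bool" where
  "has_L2_gradient \<Omega> u g \<longleftrightarrow> g \<in> L2_on \<Omega> \<and>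
     (\<forall>\<phi>\<in>test_functions \<Omega>. \<forall>b\<in>Basis.
        (LINT x|lebesgue_on \<Omega>. u x * frechet_derivative \<phi> (at x) b) =
        - (LINT x|lebesgue_on \<Omega>. (g x \<bullet> b) * \<phi> x))"

text \<open>Elements are represented by functions on the whole space; only their values on \<open>\<Omega>\<close> matter,
  and functions agreeing almost everywhere on \<open>\<Omega>\<close> are not identified.\<close>

definition H1_on :: "'a::euclidean_space set \<Rightarrow> ('a \<Rightarrow> real) set" where
  "H1_on \<Omega> = {u. u \<in> L2_on \<Omega> \<and> (\<exists>g. has_L2_gradient \<Omega> u g)}"

definition last_coord :: "real ^ ('n::{finite,linorder}) \<Rightarrow> real" where
  "last_coord x = x $ Max UNIV"

end

(*
  Let w(x) = |x_n|^p and let V be a C^1 truncation of u with V = 1 on {u >= l}, V = 0 on {u <= k}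
  and |grad V| <= 2/(l-k) |grad u| on {k < u < l}, grad V = 0 elsewhere. Every z in the ball satisfies
  1 <= |1 - V(z)| + |V(z)|, so w({u >= l}) w({u <= k}) |B_r| is at most w({u >= l}) + w({u <= k})
  times the double integral of |V(x) - V(z)| w(x), with only one of the two points weighted.
  Along the segment from x to z this is controlled by r^{n+p+1} times the L^1 norm of grad V: near x
  one fixes z and integrates out x, which costs an average of w over shrunken balls, bounded by
  t^p (p > -1); near z one fixes x. Weighting both points along straight segments would fail for p close to -1.
  Cauchy-Schwarz bounds the L^1 norm of grad V by the Dirichlet integral and |{k < u < l}|^{1/2}, and
  Hoelder with 1 = w^{2 eps} (|x_n|^q)^{1 - 2 eps}, q = -2 eps p / (1 - 2 eps) > -1, bounds the latter
  by w({k < u < l})^eps. The estimate for V passes to Sobolev functions by mollification.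
*)

theory Submission
  imports Defs
begin

section \<open>Smooth bump functions\<close>

text \<open>The bounds on \<epsilon> are what Hoelder needs: 2 \<epsilon> < 1 makes the exponent
  admissible, and 2 \<epsilon> (p + 1) < 1 is equivalent to q > -1. Weighting both endpoints breaks
  down at points y with y_n = 0: if y = (1 - t) x + t z, then x_n is a multiple of z_n, so the
  average over z is one of |z_n|^(2p), finite only for p > -1/2. The price of one unweighted point
  is |B_r| on the left, a mere power of r. The exponents of r are n + p for w({u >= l}) + w({u <=
  k}), n + p + 1 for the segments, n (1 - 2 \<epsilon>) / 2 - \<epsilon> p for Hoelder under the
  square root, and -n for |B_r|. The truncation is C^1 rather than piecewise linear so that its
  derivative, evaluated at the mollified functions, converges wherever these do; corners would
  require grad u = 0 almost everywhere on level sets. The extension of u by zero need not be Sobolev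
  across the sphere, so gradients of mollifications are used only at points further from the sphere
  than the mollification radius; Fatou's lemma exhausts the ball by the shrunken balls.\<close>

lemma C_k_Suc_iff:
  "C_k (Suc m) f \<longleftrightarrow> (\<exists>f'. (\<forall>x. (f has_derivative f' x) (at x)) \<and> (\<forall>b\<in>Basis. C_k m (\<lambda>x. f' x b)))"
proof
  assume "C_k (Suc m) f"
  then have "\<forall>x. (f has_derivative frechet_derivative f (at x)) (at x)"
    and "\<forall>b\<in>Basis. C_k m (\<lambda>x. frechet_derivative f (at x) b)"
    by (auto simp: differentiable_on_def frechet_derivative_works)
  then show "\<exists>f'. (\<forall>x. (f has_derivative f' x) (at x)) \<and> (\<forall>b\<in>Basis. C_k m (\<lambda>x. f' x b))"
    by (intro exI[of _ "\<lambda>x. frechet_derivative f (at x)"]) auto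
next
  assume "\<exists>f'. (\<forall>x. (f has_derivative f' x) (at x)) \<and> (\<forall>b\<in>Basis. C_k m (\<lambda>x. f' x b))"
  then obtain f' where *: "\<And>x. (f has_derivative f' x) (at x)" "\<forall>b\<in>Basis. C_k m (\<lambda>x. f' x b)"
    by blast
  have "frechet_derivative f (at x) = f' x" for x
    using frechet_derivative_at[OF *(1)] by simp
  with * show "C_k (Suc m) f"
    by (auto simp: differentiable_on_def differentiable_def)
qed

text \<open>Uniqueness of the derivative identifies any explicit witness with the
  \<open>frechet_derivative\<close> in the definition of \<open>C_k\<close>, so the inductions below
  only handle explicit derivatives.\<close>

lemma C_k_SucI:
  assumes "\<And>x. (f has_derivative f' x) (at x)" "\<And>b. b \<in> Basis \<Longrightarrow> C_k m (\<lambda>x. f' x b)"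
  shows "C_k (Suc m) f"
  unfolding C_k_Suc_iff using assms by blast

lemma C_k_SucE:
  assumes "C_k (Suc m) f"
  obtains f' where "\<And>x. (f has_derivative f' x) (at x)" "\<And>b. b \<in> Basis \<Longrightarrow> C_k m (\<lambda>x. f' x b)"
  using assms unfolding C_k_Suc_iff by blast

lemma C_k_SucD: "C_k (Suc m) f \<Longrightarrow> C_k m f"
proof (induction m arbitrary: f)
  case 0
  then show ?case by (auto intro: differentiable_imp_continuous_on)
next
  case (Suc m)
  then show ?case by (meson C_k.simps(2))
qed

lemma C_k_const: "C_k m (\<lambda>x. c)"
proof (induction m arbitrary: c)
  case (Suc m)
  show ?case by (rule C_k_SucI[where f'="\<lambda>x h. 0"]) (auto intro!: derivative_eq_intros Suc)
qed simp

lemma C_k_inner_diff: "C_k m (\<lambda>x. (x - a) \<bullet> b)"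
proof (cases m)
  case (Suc m)
  show ?thesis unfolding Suc
    by (rule C_k_SucI[where f'="\<lambda>x h. h \<bullet> b"]) (auto intro!: derivative_eq_intros C_k_const)
qed (auto intro!: continuous_intros)

lemma C_k_add: "C_k m f \<Longrightarrow> C_k m g \<Longrightarrow> C_k m (\<lambda>x. f x + g x)"
proof (induction m arbitrary: f g)
  case (Suc m)
  obtain f' where f': "\<And>x. (f has_derivative f' x) (at x)" "\<And>b. b \<in> Basis \<Longrightarrow> C_k m (\<lambda>x. f' x b)"
    using Suc.prems(1) by (rule C_k_SucE) auto
  obtain g' where g': "\<And>x. (g has_derivative g' x) (at x)" "\<And>b. b \<in> Basis \<Longrightarrow> C_k m (\<lambda>x. g' x b)"
    using Suc.prems(2) by (rule C_k_SucE) auto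
  show ?case
    by (rule C_k_SucI[where f'="\<lambda>x h. f' x h + g' x h"])
       (auto intro!: f' g' has_derivative_add Suc.IH)
qed (auto intro!: continuous_intros)

lemma C_k_mult: "C_k m f \<Longrightarrow> C_k m g \<Longrightarrow> C_k m (\<lambda>x. f x * g x)"
proof (induction m arbitrary: f g)
  case (Suc m)
  obtain f' where f': "\<And>x. (f has_derivative f' x) (at x)" "\<And>b. b \<in> Basis \<Longrightarrow> C_k m (\<lambda>x. f' x b)"
    using Suc.prems(1) by (rule C_k_SucE) auto
  obtain g' where g': "\<And>x. (g has_derivative g' x) (at x)" "\<And>b. b \<in> Basis \<Longrightarrow> C_k m (\<lambda>x. g' x b)"
    using Suc.prems(2) by (rule C_k_SucE) auto
  show ?case
    by (rule C_k_SucI[where f'="\<lambda>x h. f x * g' x h + f' x h * g x"])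
       (auto intro!: f' g' has_derivative_mult Suc.IH C_k_add C_k_SucD[OF Suc.prems(1)]
          C_k_SucD[OF Suc.prems(2)])
qed (auto intro!: continuous_intros)

text \<open>The family \<open>flat_exp j\<close> is closed under differentiation up to linear combinations.\<close>

definition flat_exp :: "nat \<Rightarrow> real \<Rightarrow> real" where
  "flat_exp j t = (if t > 0 then exp (- 1 / t) / t ^ j else 0)"

lemma flat_exp_nonneg: "0 \<le> flat_exp j t"
  by (simp add: flat_exp_def)

text \<open>A single term of the series of exp (1/t), the one of order j + m, is already at most the
  whole sum. The case m = 2 gives differentiability at 0, the case m = 0 a uniform bound.\<close>

lemma flat_exp_le: "flat_exp j t \<le> fact (j + m) * \<bar>t\<bar> ^ m"
proof (cases "t > 0")
  case True
  have "(1 / t) ^ (j + m) / fact (j + m) \<le> exp (1 / t)"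
  proof -
    have s: "(\<lambda>n. (1/t) ^ n / fact n) sums exp (1/t)"
      using exp_converges[of "1/t"] by (simp add: field_simps)
    have "(\<Sum>n\<in>{j+m}. (1/t) ^ n / fact n) \<le> exp (1 / t)"
      using sum_le_suminf[OF sums_summable[OF s], of "{j+m}"] s True
      by (simp add: sums_iff)
    then show ?thesis by simp
  qed
  then have "1 \<le> fact (j + m) * t ^ (j + m) * exp (1/t)"
    using True by (simp add: field_simps)
  then have "exp (- (1/t)) \<le> fact (j + m) * t ^ (j + m)"
    by (simp add: exp_minus field_simps)
  then show ?thesis
    using True by (simp add: flat_exp_def field_simps power_add)
qed (simp add: flat_exp_def)

text \<open>For t > 0 this is the quotient rule. At 0 the quadratic bound on
  \<open>flat_exp j\<close> forces the difference quotient to 0, which is also the value of the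
  right-hand side.\<close>

lemma has_field_derivative_flat_exp [derivative_intros]:
  "(flat_exp j has_field_derivative flat_exp (j + 2) t - real j * flat_exp (j + 1) t) (at t)"
proof -
  consider "t > 0" | "t < 0" | "t = 0" by linarith
  then show ?thesis
  proof cases
    case 1
    have pow: "((\<lambda>t. t ^ j) has_field_derivative real j * t ^ j / t) (at t)"
      using DERIV_pow[of j t] 1 by (cases j) auto
    have exp: "((\<lambda>t. exp (- 1 / t)) has_field_derivative exp (- 1 / t) / t\<^sup>2) (at t)"
      using 1 by (auto intro!: derivative_eq_intros simp: power2_eq_square)
    have "((\<lambda>t. exp (- 1 / t) / t ^ j) has_field_derivative
        (exp (- 1 / t) / t\<^sup>2 * t ^ j - exp (- 1 / t) * (real j * t ^ j / t)) / (t ^ j * t ^ j)) (at t)"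
      using 1 by (intro DERIV_divide exp pow) auto
    also have "(exp (- 1 / t) / t\<^sup>2 * t ^ j - exp (- 1 / t) * (real j * t ^ j / t)) / (t ^ j * t ^ j)
        = flat_exp (j + 2) t - real j * flat_exp (j + 1) t"
    proof -
      have *: "(E / t\<^sup>2 * T - E * (J * T / t)) / (T * T) = E / (T * t\<^sup>2) - J * (E / (T * t))"
        if "T \<noteq> 0" for E J T :: real
        using that 1 by (simp add: field_simps power2_eq_square)
      show ?thesis
        using 1 by (subst *) (simp_all add: flat_exp_def power_add power2_eq_square mult_ac)
    qed
    finally have "((\<lambda>t. exp (- 1 / t) / t ^ j) has_field_derivative
        flat_exp (j + 2) t - real j * flat_exp (j + 1) t) (at t)" .
    then show ?thesis
      by (rule has_field_derivative_transform_within[OF _ 1]) (auto simp: flat_exp_def dist_real_def)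
  next
    case 2
    have "((\<lambda>t. 0) has_field_derivative 0) (at t)" by simp
    then have "(flat_exp j has_field_derivative 0) (at t)"
      by (rule has_field_derivative_transform_within[of _ _ _ _ "-t"])
         (use 2 in \<open>auto simp: flat_exp_def dist_real_def\<close>)
    with 2 show ?thesis by (simp add: flat_exp_def)
  next
    case 3
    have "((\<lambda>h. flat_exp j h / h) \<longlongrightarrow> 0) (at 0)"
    proof (rule Lim_null_comparison)
      show "\<forall>\<^sub>F h in at 0. norm (flat_exp j h / h) \<le> fact (j + 2) * \<bar>h\<bar>"
      proof (intro eventually_at_topological[THEN iffD2] exI[of _ UNIV] conjI ballI impI)
        fix h :: real assume "h \<noteq> 0"
        have "flat_exp j h \<le> fact (j + 2) * \<bar>h\<bar> * \<bar>h\<bar>"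
          using flat_exp_le[of j h 2] by (metis mult.assoc power2_eq_square)
        with \<open>h \<noteq> 0\<close> show "norm (flat_exp j h / h) \<le> fact (j + 2) * \<bar>h\<bar>"
          using flat_exp_nonneg[of j h]
          by (simp only: real_norm_def abs_divide abs_of_nonneg pos_divide_le_eq zero_less_abs_iff simp_thms)
      qed auto
      show "((\<lambda>h::real. fact (j + 2) * \<bar>h\<bar>) \<longlongrightarrow> 0) (at 0)"
        by (auto intro!: tendsto_eq_intros)
    qed
    then have "(flat_exp j has_field_derivative 0) (at 0)"
      by (simp add: has_field_derivative_iff flat_exp_def)
    with 3 show ?thesis by (simp add: flat_exp_def)
  qed
qed

text \<open>The squared norm keeps the function smooth at the origin. The index j is carried along
  because differentiating \<open>bump 0\<close> leads to \<open>bump 2\<close>, and so on.\<close>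

definition bump :: "nat \<Rightarrow> real \<Rightarrow> 'a::euclidean_space \<Rightarrow> real" where
  "bump j d x = flat_exp j (d\<^sup>2 - x \<bullet> x)"

lemma has_derivative_bump:
  "((\<lambda>y. bump j d (y - a)) has_derivative
     (\<lambda>h. (bump (j + 2) d (y - a) - real j * bump (j + 1) d (y - a)) * (- 2 * ((y - a) \<bullet> h)))) (at y)"
proof -
  have 1: "((\<lambda>y. d\<^sup>2 - (y - a) \<bullet> (y - a)) has_derivative (\<lambda>h. - 2 * ((y - a) \<bullet> h))) (at y)"
    by (auto intro!: derivative_eq_intros simp: inner_commute)
  have 2: "(flat_exp j has_derivative (\<lambda>s. (flat_exp (j + 2) t - real j * flat_exp (j + 1) t) * s)) (at t)" for t
    using has_field_derivative_flat_exp[of j t] by (simp add: has_field_derivative_def)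
  show ?thesis
    using has_derivative_compose[OF 1 2] by (simp add: bump_def)
qed

text \<open>The induction on m must hold for all j at once, since the derivative of
  \<open>bump j\<close> involves \<open>bump (j + 1)\<close> and
  \<open>bump (j + 2)\<close>.\<close>

lemma C_k_bump: "C_k m (\<lambda>y. bump j d (y - a))"
proof (induction m arbitrary: j)
  case 0
  show ?case
    by (simp add: continuous_on_eq_continuous_at)
       (blast intro: has_derivative_continuous has_derivative_bump)
next
  case (Suc m)
  \<comment> \<open>The difference is turned into a sum with a constant multiple, so that closure
    under sums and products suffices.\<close>
  have eq: "(\<lambda>y. (bump (j + 2) d (y - a) - real j * bump (j + 1) d (y - a)) * (- 2 * ((y - a) \<bullet> b)))
     = (\<lambda>y. (bump (j + 2) d (y - a) + (- real j) * bump (j + 1) d (y - a)) * (- 2 * ((y - a) \<bullet> b)))" for b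
    by simp
  show ?case
    by (rule C_k_SucI[OF has_derivative_bump], unfold eq)
       (intro C_k_mult C_k_add Suc.IH C_k_const C_k_inner_diff)
qed

lemma bump_nonneg: "0 \<le> bump j d x"
  by (simp add: bump_def flat_exp_nonneg)

lemma bump_eq_0: "d \<ge> 0 \<Longrightarrow> d \<le> norm x \<Longrightarrow> bump j d x = 0"
  by (metis bump_def diff_gt_0_iff_gt dot_square_norm flat_exp_def not_less power_mono)

lemma bump_0_pos: "norm x < d \<Longrightarrow> bump 0 d x > 0"
  using power_strict_mono[of "norm x" d 2] by (simp add: bump_def flat_exp_def dot_square_norm)

lemma bump_minus: "bump j d (- x) = bump j d x"
  by (simp add: bump_def)

lemma bump_le: "bump j d x \<le> fact j"
  using flat_exp_le[of j "d\<^sup>2 - x \<bullet> x" 0] by (simp add: bump_def)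

lemma bump_test_function:
  assumes "d > 0" "cball a d \<subseteq> S"
  shows "(\<lambda>y. bump j d (y - a)) \<in> test_functions S"
  unfolding test_functions_def using assms
  by (auto intro!: C_k_bump exI[of _ "cball a d"] bump_eq_0 simp: dist_norm norm_minus_commute)

lemma frechet_derivative_bump:
  "frechet_derivative (\<lambda>y. bump 0 d (y - a)) (at y) h = - 2 * bump 2 d (y - a) * ((y - a) \<bullet> h)"
  using frechet_derivative_at[OF has_derivative_bump[of 0 d a y], symmetric]
  by (simp add: fun_eq_iff numeral_2_eq_2)

text \<open>On the support the norm of x is below d, and \<open>bump 2\<close> is at most 2! = 2;
  together with the factor 2 this gives 4 d.\<close>

lemma bump_gradient_le:
  assumes "d > 0"
  shows "\<bar>2 * bump 2 d x * (x \<bullet> h)\<bar> \<le> 4 * d * norm h"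
proof (cases "norm x < d")
  case True
  have "\<bar>2 * bump 2 d x * (x \<bullet> h)\<bar> = 2 * bump 2 d x * \<bar>x \<bullet> h\<bar>"
    using bump_nonneg[of 2 d x] by (simp add: abs_mult)
  also have "\<dots> \<le> 2 * 2 * (norm x * norm h)"
    using bump_le[of 2 d x] bump_nonneg[of 2 d x]
    by (intro mult_mono Cauchy_Schwarz_ineq2) auto
  also have "\<dots> \<le> 4 * d * norm h"
    using True by (simp add: mult_right_mono)
  finally show ?thesis .
qed (use assms in \<open>simp add: bump_eq_0\<close>)

lemma bump_lipschitz:
  fixes x y :: "'a::euclidean_space"
  assumes "d > 0"
  shows "\<bar>bump 0 d x - bump 0 d y\<bar> \<le> 4 * d * norm (x - y)"
proof -
  have "norm (bump 0 d (x - 0) - bump 0 d (y - 0)) \<le> 4 * d * norm (x - y)"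
  proof (rule differentiable_bound[OF convex_UNIV has_derivative_at_withinI[OF has_derivative_bump]])
    fix z :: 'a
    show "onorm (\<lambda>h. (bump (0 + 2) d (z - 0) - real 0 * bump (0 + 1) d (z - 0)) * (- 2 * ((z - 0) \<bullet> h))) \<le> 4 * d"
    proof (rule onorm_bound)
      show "0 \<le> 4 * d" using assms by simp
      fix h :: 'a
      show "norm ((bump (0 + 2) d (z - 0) - real 0 * bump (0 + 1) d (z - 0)) * (- 2 * ((z - 0) \<bullet> h)))
          \<le> 4 * d * norm h"
        using bump_gradient_le[OF assms, of z h] by (simp add: abs_mult numeral_2_eq_2)
    qed
  qed auto
  then show ?thesis by simp
qed

lemma continuous_on_bump: "continuous_on UNIV (bump j d)"
  using C_k_bump[of 0 j d 0] by simp

lemma borel_measurable_bump [measurable]: "bump j d \<in> borel_measurable borel"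
  by (rule borel_measurable_continuous_onI[OF continuous_on_bump])

section \<open>Continuity of translations in the mean\<close>

lemma nn_integral_lborel_affine:
  fixes t :: "'a::euclidean_space"
  assumes "c \<noteq> 0" and [measurable]: "f \<in> borel_measurable borel"
  shows "(\<integral>\<^sup>+x. f x \<partial>lborel) = ennreal (\<bar>c\<bar> ^ DIM('a)) * (\<integral>\<^sup>+x. f (t + c *\<^sub>R x) \<partial>lborel)"
proof -
  have "(\<integral>\<^sup>+x. f x \<partial>lborel)
      = (\<integral>\<^sup>+x. f x \<partial>density (distr lborel borel (\<lambda>x. t + c *\<^sub>R x)) (\<lambda>_. ennreal (\<bar>c\<bar> ^ DIM('a))))"
    by (subst lborel_affine[OF assms(1), of t]) simp
  also have "\<dots> = ennreal (\<bar>c\<bar> ^ DIM('a)) * (\<integral>\<^sup>+x. f (t + c *\<^sub>R x) \<partial>lborel)"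
    by (simp add: nn_integral_density nn_integral_distr nn_integral_cmult)
  finally show ?thesis .
qed

lemma nn_integral_lborel_translate:
  fixes t :: "'a::euclidean_space"
  assumes "f \<in> borel_measurable borel"
  shows "(\<integral>\<^sup>+x. f (t + x) \<partial>lborel) = (\<integral>\<^sup>+x. f x \<partial>lborel)"
  using nn_integral_lborel_affine[of 1 f t] assms by simp

lemma nn_integral_lborel_reflect:
  fixes t :: "'a::euclidean_space"
  assumes "f \<in> borel_measurable borel"
  shows "(\<integral>\<^sup>+x. f (t - x) \<partial>lborel) = (\<integral>\<^sup>+x. f x \<partial>lborel)"
  using nn_integral_lborel_affine[of "-1" f t] assms by simp

lemma integrable_lborel_translate:
  fixes t :: "'a::euclidean_space" and f :: "'a \<Rightarrow> 'b::{banach, second_countable_topology}"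
  assumes "integrable lborel f"
  shows "integrable lborel (\<lambda>x. f (t + x))"
proof -
  have [measurable]: "f \<in> borel_measurable borel" using assms by auto
  show ?thesis
    using assms nn_integral_lborel_translate[of "\<lambda>x. ennreal (norm (f x))" t]
    by (simp add: integrable_iff_bounded)
qed

lemma integral_lborel_translate:
  fixes t :: "'a::euclidean_space" and f :: "'a \<Rightarrow> 'b::{banach, second_countable_topology}"
  assumes "f \<in> borel_measurable borel"
  shows "(\<integral>x. f (t + x) \<partial>lborel) = (\<integral>x. f x \<partial>lborel)"
proof -
  have "(\<integral>x. f x \<partial>lborel) = (\<integral>x. f x \<partial>distr lborel borel ((+) t))"
    by (simp add: lborel_distr_plus)
  then show ?thesis using assms by (simp add: integral_distr)
qed

text \<open>The boundary of U may have positive measure, and there the indicators need not converge.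
  By translation invariance, however, the positive and negative parts of the difference have the
  same integral, so only points of U count, and for these openness gives h + x in U once h is
  small.\<close>

lemma L1_translation_indicator_open:
  fixes U :: "'a::euclidean_space set"
  assumes "open U" "emeasure lborel U < \<infinity>"
  shows "((\<lambda>h. \<integral>x. \<bar>indicator U (h + x) - indicator U x\<bar> \<partial>lborel) \<longlongrightarrow> (0::real)) (at 0)"
proof -
  have [measurable]: "U \<in> sets borel" using assms by auto
  have int: "integrable lborel (\<lambda>x. indicator U x :: real)"
    using assms by simp
  have int': "integrable lborel (\<lambda>x. indicator U (h + x) :: real)" for h
    by (rule integrable_lborel_translate[OF int])
  have eq: "(\<integral>x. \<bar>indicator U (h + x) - indicator U x\<bar> \<partial>lborel)
      = (2::real) * (\<integral>x. max 0 (indicator U x - indicator U (h + x)) \<partial>lborel)" (is "?l = _") for h :: 'a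
  proof -
    have intm: "integrable lborel (\<lambda>x. max 0 (indicator U x - indicator U (h + x)) :: real)"
      by (intro integrable_max Bochner_Integration.integrable_diff int int') simp
    have "?l = (\<integral>x. 2 * max 0 (indicator U x - indicator U (h + x)) +
        (indicator U (h + x) - indicator U x) \<partial>lborel)"
      by (intro Bochner_Integration.integral_cong refl) (auto simp: max_def)
    also have "\<dots> = 2 * (\<integral>x. max 0 (indicator U x - indicator U (h + x)) \<partial>lborel) +
        ((\<integral>x. indicator U (h + x) \<partial>lborel) - (\<integral>x. indicator U x \<partial>lborel))"
      by (subst Bochner_Integration.integral_add)
        (use intm int int'[of h] in \<open>auto simp: Bochner_Integration.integral_diff[OF int'[of h] int]\<close>)
    also have "(\<integral>x. indicator U (h + x) \<partial>lborel) = (\<integral>x. (indicator U x :: real) \<partial>lborel)"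
      by (rule integral_lborel_translate) simp
    finally show ?thesis by simp
  qed
  have "((\<lambda>h. \<integral>x. max 0 (indicator U x - indicator U (h + x)) \<partial>lborel) \<longlongrightarrow> (0::real)) (at 0)"
    unfolding tendsto_at_iff_sequentially comp_def
  proof safe
    fix h :: "nat \<Rightarrow> 'a" assume h: "h \<longlonglongrightarrow> 0"
    have "(\<lambda>n. \<integral>x. max 0 (indicator U x - indicator U (h n + x)) \<partial>lborel) \<longlonglongrightarrow> integral\<^sup>L (lborel :: 'a measure) (\<lambda>x. 0::real)"
    proof (rule integral_dominated_convergence[where w="indicator U"])
      show "AE x in lborel. (\<lambda>n. max 0 (indicator U x - indicator U (h n + x)) :: real) \<longlonglongrightarrow> 0"
      proof (intro AE_I2 tendsto_eventually)
        fix x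
        show "\<forall>\<^sub>F n in sequentially. max 0 (indicator U x - indicator U (h n + x) :: real) = 0"
        proof (cases "x \<in> U")
          case True
          have "(\<lambda>n. h n + x) \<longlonglongrightarrow> 0 + x" by (intro tendsto_intros h)
          then have "\<forall>\<^sub>F n in sequentially. h n + x \<in> U"
            using True assms(1) topological_tendstoD by fastforce
          then show ?thesis by eventually_elim (use True in auto)
        qed auto
      qed
      show "AE x in lborel. norm (max 0 (indicator U x - indicator U (h n + x)) :: real) \<le> indicator U x" for n
        by (auto simp: indicator_def)
    qed (simp_all add: int)
    then show "(\<lambda>n. \<integral>x. max 0 (indicator U x - indicator U (h n + x)) \<partial>lborel) \<longlonglongrightarrow> (0::real)"
      by simp
  qed
  from tendsto_mult[OF tendsto_const[of 2] this] show ?thesis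
    by (simp add: eq)
qed

text \<open>Replacing f by g costs one error at h + x and one at x; translation invariance makes
  them equal, hence the factor 2.\<close>

lemma nn_integral_translate_triangle:
  fixes f g :: "'a::euclidean_space \<Rightarrow> 'b::{banach, second_countable_topology}"
  assumes [measurable]: "f \<in> borel_measurable borel" "g \<in> borel_measurable borel"
  shows "(\<integral>\<^sup>+x. norm (f (h + x) - f x) \<partial>lborel) \<le>
    2 * (\<integral>\<^sup>+x. norm (f x - g x) \<partial>lborel) + (\<integral>\<^sup>+x. norm (g (h + x) - g x) \<partial>lborel)"
proof -
  have tri: "norm (a - b) \<le> norm (a - c) + (norm (b - d) + norm (c - d))" for a b c d :: 'b
    using norm_triangle_ineq[of "a - c" "c - b"] norm_triangle_ineq[of "c - d" "d - b"]
    by (simp add: norm_minus_commute)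
  have "(\<integral>\<^sup>+x. norm (f (h + x) - f x) \<partial>lborel) \<le>
      (\<integral>\<^sup>+x. ennreal (norm (f (h + x) - g (h + x))) + (ennreal (norm (f x - g x)) + ennreal (norm (g (h + x) - g x))) \<partial>lborel)"
    by (intro nn_integral_mono)
       (simp flip: ennreal_plus, use tri in blast)
  also have "\<dots> = (\<integral>\<^sup>+x. norm (f (h + x) - g (h + x)) \<partial>lborel)
      + ((\<integral>\<^sup>+x. norm (f x - g x) \<partial>lborel) + (\<integral>\<^sup>+x. norm (g (h + x) - g x) \<partial>lborel))"
    by (simp add: nn_integral_add)
  also have "(\<integral>\<^sup>+x. norm (f (h + x) - g (h + x)) \<partial>lborel) = (\<integral>\<^sup>+x. norm (f x - g x) \<partial>lborel)"
    by (rule nn_integral_lborel_translate) simp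
  finally show ?thesis by (simp add: mult_2 add_ac)
qed

text \<open>Indicators of Borel sets are compared with open sets by outer regularity; the property
  then passes to sums and to dominated limits.\<close>

lemma L1_translation_continuous:
  fixes f :: "'a::euclidean_space \<Rightarrow> 'b::{banach, second_countable_topology}"
  assumes "integrable lborel f" "e > 0"
  shows "\<exists>d>0. \<forall>h. norm h < d \<longrightarrow> (\<integral>\<^sup>+x. norm (f (h + x) - f x) \<partial>lborel) \<le> ennreal e"
  using assms
proof (induction arbitrary: e rule: integrable_induct)
  case (base A c)
  have A[measurable]: "A \<in> sets borel" using base by simp
  \<comment> \<open>The approximation by an open set contributes twice and the translation of the
    open set once, hence the 3; the summand 1 avoids dividing by zero when c = 0.\<close>
  define e' where "e' = e / (3 * (norm c + 1))"
  have e': "e' > 0" using base by (simp add: e'_def divide_pos_pos add_nonneg_pos)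
  obtain U where U: "open U" "A \<subseteq> U" "emeasure lebesgue (U - A) < ennreal e'"
  proof (rule sets_lebesgue_outer_open)
    show "A \<in> sets lebesgue" by (simp add: sets_completionI_sets)
  qed (use e' in blast)+
  have [measurable]: "U \<in> sets borel" using U by auto
  have UA: "emeasure lborel (U - A) < ennreal e'" using U(3) by simp
  have "emeasure lborel U \<le> emeasure lborel (U - A) + emeasure lborel A"
  proof -
    have "emeasure lborel U = emeasure lborel ((U - A) \<union> A)"
      using U(2) by (intro arg_cong[of _ _ "emeasure lborel"]) auto
    also have "\<dots> \<le> emeasure lborel (U - A) + emeasure lborel A"
      by (rule emeasure_subadditive) auto
    finally show ?thesis .
  qed
  also have "\<dots> < \<infinity>"
    using base(2) order_less_trans[OF UA ennreal_less_top] by (simp add: less_top)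
  finally have finU: "emeasure lborel U < \<infinity>" .
  have "\<forall>\<^sub>F h in at 0. (\<integral>x. \<bar>indicator U (h + x) - indicator U x\<bar> \<partial>lborel) < e'"
    using order_tendstoD(2)[OF L1_translation_indicator_open[OF U(1) finU] e'] .
  then obtain d where d: "d > 0"
    "\<And>h. h \<noteq> 0 \<Longrightarrow> norm h < d \<Longrightarrow> (\<integral>x. \<bar>indicator U (h + x) - indicator U x\<bar> \<partial>lborel) < e'"
    by (auto simp: eventually_at)
  have "(\<integral>\<^sup>+x. norm (indicator A (h + x) *\<^sub>R c - indicator A x *\<^sub>R c) \<partial>lborel) \<le> ennreal e"
    if "norm h < d" for h
  proof (cases "h = 0")
    case False
    have 1: "(\<integral>\<^sup>+x. norm (indicator U (h + x) - indicator U x :: real) \<partial>lborel) \<le> ennreal e'"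
    proof -
      have "integrable lborel (\<lambda>x. \<bar>indicator U (h + x) - indicator U x :: real\<bar>)"
        using finU by (intro integrable_abs Bochner_Integration.integrable_diff integrable_lborel_translate) auto
      then have "(\<integral>\<^sup>+x. norm (indicator U (h + x) - indicator U x :: real) \<partial>lborel)
          = ennreal (\<integral>x. \<bar>indicator U (h + x) - indicator U x\<bar> \<partial>lborel)"
        by (simp add: nn_integral_eq_integral)
      then show ?thesis using d(2)[OF False that] by (simp add: ennreal_leI)
    qed
    have 2: "(\<integral>\<^sup>+x. norm (indicator A x - indicator U x :: real) \<partial>lborel) \<le> ennreal e'"
    proof -
      have "(\<integral>\<^sup>+x. norm (indicator A x - indicator U x :: real) \<partial>lborel) = (\<integral>\<^sup>+x. indicator (U - A) x \<partial>lborel)"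
        using U(2) by (intro nn_integral_cong) (auto simp: indicator_def)
      then show ?thesis using UA by simp
    qed
    have "(\<integral>\<^sup>+x. norm (indicator A (h + x) *\<^sub>R c - indicator A x *\<^sub>R c) \<partial>lborel)
        = (\<integral>\<^sup>+x. ennreal (norm c) * norm (indicator A (h + x) - indicator A x :: real) \<partial>lborel)"
      by (intro nn_integral_cong) (simp flip: scaleR_diff_left ennreal_mult add: mult.commute)
    also have "\<dots> = ennreal (norm c) * (\<integral>\<^sup>+x. norm (indicator A (h + x) - indicator A x :: real) \<partial>lborel)"
      by (rule nn_integral_cmult) simp
    also have "\<dots> \<le> ennreal (norm c) * (2 * ennreal e' + ennreal e')"
      by (intro mult_left_mono order_trans[OF nn_integral_translate_triangle[of _ "indicator U"]]
        add_mono 1 2) auto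
    also have "2 * ennreal e' + ennreal e' = ennreal (2 * e' + e')"
      using e' by (subst ennreal_plus) (auto simp: ennreal_mult)
    also have "ennreal (norm c) * ennreal (2 * e' + e') = ennreal (norm c * (3 * e'))"
      using e' by (subst ennreal_mult[symmetric]) auto
    also have "\<dots> \<le> ennreal e"
    proof (intro ennreal_leI)
      have "norm c + 1 > 0" by (rule add_nonneg_pos) auto
      then have "e = 3 * e' * (norm c + 1)" by (simp add: e'_def field_simps)
      with e' show "norm c * (3 * e') \<le> e" by (simp add: algebra_simps)
    qed
    finally show ?thesis .
  qed simp
  with d(1) show ?case by blast
next
  case (add f g)
  have [measurable]: "f \<in> borel_measurable borel" "g \<in> borel_measurable borel" using add by auto
  obtain d1 where d1: "d1 > 0" "\<And>h. norm h < d1 \<Longrightarrow> (\<integral>\<^sup>+x. norm (f (h + x) - f x) \<partial>lborel) \<le> ennreal (e/2)"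
    using add.IH(1)[of "e/2"] add.prems by auto
  obtain d2 where d2: "d2 > 0" "\<And>h. norm h < d2 \<Longrightarrow> (\<integral>\<^sup>+x. norm (g (h + x) - g x) \<partial>lborel) \<le> ennreal (e/2)"
    using add.IH(2)[of "e/2"] add.prems by auto
  have "(\<integral>\<^sup>+x. norm (f (h + x) + g (h + x) - (f x + g x)) \<partial>lborel) \<le> ennreal e" if "norm h < min d1 d2" for h
  proof -
    have "(\<integral>\<^sup>+x. norm (f (h + x) + g (h + x) - (f x + g x)) \<partial>lborel) \<le>
      (\<integral>\<^sup>+x. ennreal (norm (f (h + x) - f x)) + ennreal (norm (g (h + x) - g x)) \<partial>lborel)"
      by (intro nn_integral_mono) (simp flip: ennreal_plus add: norm_diff_triangle_ineq)
    also have "\<dots> = (\<integral>\<^sup>+x. norm (f (h + x) - f x) \<partial>lborel) + (\<integral>\<^sup>+x. norm (g (h + x) - g x) \<partial>lborel)"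
      by (simp add: nn_integral_add)
    also have "\<dots> \<le> ennreal (e/2) + ennreal (e/2)"
      using that by (intro add_mono d1(2) d2(2)) auto
    also have "\<dots> = ennreal e" using add.prems by (simp flip: ennreal_plus)
    finally show ?thesis .
  qed
  with d1(1) d2(1) show ?case by (intro exI[of _ "min d1 d2"]) auto
next
  case (lim f s)
  have [measurable]: "f \<in> borel_measurable borel" "\<And>i. s i \<in> borel_measurable borel" using lim by auto
  have "(\<lambda>i. \<integral>\<^sup>+x. norm (f x - s i x) \<partial>lborel) \<longlonglongrightarrow> 0"
  proof (rule nn_integral_dominated_convergence_norm[where w="\<lambda>x. 2 * norm (f x)"])
    show "(\<integral>\<^sup>+x. ennreal (2 * norm (f x)) \<partial>lborel) < \<infinity>"
      using \<open>integrable lborel f\<close>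
      by (simp add: integrable_iff_bounded ennreal_mult nn_integral_cmult ennreal_mult_less_top)
  qed (use lim in auto)
  \<comment> \<open>The error of the approximation enters twice, so it is made e/4, which leaves e/2
    for the translation of \<open>s i\<close>.\<close>
  then have "\<forall>\<^sub>F i in sequentially. (\<integral>\<^sup>+x. norm (f x - s i x) \<partial>lborel) < ennreal (e/4)"
    using lim.prems by (intro order_tendstoD(2)) auto
  then obtain i where i: "(\<integral>\<^sup>+x. norm (f x - s i x) \<partial>lborel) < ennreal (e/4)"
    by (auto simp: eventually_sequentially)
  obtain d where d: "d > 0" "\<And>h. norm h < d \<Longrightarrow> (\<integral>\<^sup>+x. norm (s i (h + x) - s i x) \<partial>lborel) \<le> ennreal (e/2)"
    using lim.IH(1)[of "e/2" i] lim.prems by auto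
  have "(\<integral>\<^sup>+x. norm (f (h + x) - f x) \<partial>lborel) \<le> ennreal e" if "norm h < d" for h
  proof -
    have "(\<integral>\<^sup>+x. norm (f (h + x) - f x) \<partial>lborel) \<le> 2 * ennreal (e/4) + ennreal (e/2)"
      using i by (intro order_trans[OF nn_integral_translate_triangle[of f "s i"]] add_mono mult_left_mono d(2) that) auto
    also have "\<dots> = ennreal (2 * (e/4) + e/2)"
      using lim.prems by (subst ennreal_plus, simp, simp, subst ennreal_mult) auto
    also have "\<dots> = ennreal e" by simp
    finally show ?thesis .
  qed
  with d(1) show ?case by blast
qed

section \<open>Mollification\<close>

lemma integrable_bump:
  assumes "d > 0"
  shows "integrable lborel (bump j d)"
proof -
  have "integrable lborel (\<lambda>x::'a. indicator (cball 0 d) x *\<^sub>R bump j d x)"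
    by (intro borel_integrable_compact continuous_on_subset[OF continuous_on_bump]) auto
  also have "(\<lambda>x::'a. indicator (cball 0 d) x *\<^sub>R bump j d x) = bump j d"
    using assms by (auto simp: fun_eq_iff indicator_def bump_eq_0)
  finally show ?thesis .
qed

lemma integral_bump_pos:
  assumes "d > 0"
  shows "(\<integral>x. bump 0 d (x::'a::euclidean_space) \<partial>lborel) > 0"
proof -
  have "\<not> (AE x::'a in lborel. bump 0 d x = 0)"
  proof
    assume "AE x::'a in lborel. bump 0 d x = 0"
    then have "AE x::'a in lborel. x \<notin> ball 0 d"
      by eventually_elim (use bump_0_pos[of _ d] in force)
    then have "emeasure lborel (ball (0::'a) d) = 0"
      by (subst (asm) AE_iff_measurable[of "ball 0 d"]) auto
    then have "negligible (ball (0::'a) d)"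
      by (simp add: negligible_iff_null_sets null_setsI null_sets_completionI)
    then show False
      using open_not_negligible[of "ball (0::'a) d"] assms by simp
  qed
  then have "(\<integral>x. bump 0 d (x::'a) \<partial>lborel) \<noteq> 0"
    using integral_nonneg_eq_0_iff_AE[OF integrable_bump[OF assms, where j=0 and 'a='a]] by (simp add: bump_nonneg)
  moreover have "(\<integral>x. bump 0 d (x::'a) \<partial>lborel) \<ge> 0"
    by (simp add: bump_nonneg)
  ultimately show ?thesis by simp
qed

definition mollifier :: "real \<Rightarrow> 'a::euclidean_space \<Rightarrow> real" where
  "mollifier d x = bump 0 d x / (\<integral>y. bump 0 d (y::'a) \<partial>lborel)"

definition mollify :: "real \<Rightarrow> ('a::euclidean_space \<Rightarrow> 'b::euclidean_space) \<Rightarrow> 'a \<Rightarrow> 'b" where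
  "mollify d f x = (\<integral>y. mollifier d (x - y) *\<^sub>R f y \<partial>lborel)"

lemma borel_measurable_mollifier [measurable]: "mollifier d \<in> borel_measurable borel"
  unfolding mollifier_def by measurable

lemma mollifier_nonneg: "0 \<le> mollifier d x"
  by (simp add: mollifier_def bump_nonneg)

lemma mollifier_minus: "mollifier d (- x) = mollifier d x"
  by (simp add: mollifier_def bump_minus)

lemma mollifier_eq_0: "d > 0 \<Longrightarrow> d \<le> norm x \<Longrightarrow> mollifier d x = 0"
  by (simp add: mollifier_def bump_eq_0)

lemma integrable_mollifier: "d > 0 \<Longrightarrow> integrable lborel (mollifier d)"
  unfolding mollifier_def by (intro integrable_divide integrable_bump)

lemma nn_integral_mollifier:
  assumes "d > 0"
  shows "(\<integral>\<^sup>+x. mollifier d x \<partial>lborel) = 1"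
proof -
  have "(\<integral>\<^sup>+x. mollifier d (x::'a) \<partial>lborel) = ennreal (\<integral>x. mollifier d (x::'a) \<partial>lborel)"
    by (intro nn_integral_eq_integral integrable_mollifier assms) (simp add: mollifier_nonneg)
  also have "(\<integral>x. mollifier d (x::'a) \<partial>lborel) = 1"
    using integral_bump_pos[OF assms, where 'a='a] by (simp add: mollifier_def)
  finally show ?thesis by simp
qed

text \<open>One constant serves both as supremum and as Lipschitz constant: \<open>bump 0\<close> is
  bounded by 1 and has Lipschitz constant 4 d, and both are divided by the mass. It supplies the
  dominating functions below.\<close>

lemma mollifier_bounds:
  assumes "d > 0"
  shows "\<exists>L>0. (\<forall>x::'a::euclidean_space. mollifier d x \<le> L) \<and>
    (\<forall>x y::'a. \<bar>mollifier d x - mollifier d y\<bar> \<le> L * norm (x - y))"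
proof -
  define m where "m = (\<integral>y. bump 0 d (y::'a) \<partial>lborel)"
  have m: "m > 0" unfolding m_def by (rule integral_bump_pos[OF assms])
  have "mollifier d x \<le> max 1 (4 * d) / m" for x :: 'a
    using bump_le[of 0 d x] m unfolding mollifier_def m_def[symmetric]
    by (intro divide_right_mono) auto
  moreover have "\<bar>mollifier d x - mollifier d y\<bar> \<le> max 1 (4 * d) / m * norm (x - y)" for x y :: 'a
  proof -
    have "\<bar>mollifier d x - mollifier d y\<bar> = \<bar>bump 0 d x - bump 0 d y\<bar> / m"
      using m by (simp add: mollifier_def m_def[symmetric] diff_divide_distrib[symmetric])
    also have "\<dots> \<le> max 1 (4 * d) * norm (x - y) / m"
      using m by (intro divide_right_mono order_trans[OF bump_lipschitz[OF assms]] mult_right_mono) auto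
    finally show ?thesis by simp
  qed
  moreover have "max 1 (4 * d) / m > 0" using m by auto
  ultimately show ?thesis by blast
qed

lemma integrable_mollify:
  fixes f :: "'a::euclidean_space \<Rightarrow> 'b::euclidean_space"
  assumes "d > 0" "integrable lborel f"
  shows "integrable lborel (\<lambda>y. mollifier d (x - y) *\<^sub>R f y)"
proof -
  obtain L where L: "L > 0" "\<And>x::'a. mollifier d x \<le> L"
    using mollifier_bounds[OF assms(1), where 'a='a] by blast
  have [measurable]: "f \<in> borel_measurable borel" using assms by auto
  show ?thesis
  proof (rule Bochner_Integration.integrable_bound)
    show "integrable lborel (\<lambda>y. L *\<^sub>R norm (f y))" using assms by simp
    show "AE y in lborel. norm (mollifier d (x - y) *\<^sub>R f y) \<le> norm (L *\<^sub>R norm (f y))"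
      using L by (auto simp: mollifier_nonneg intro!: mult_right_mono)
  qed measurable
qed

text \<open>The kernel is Lipschitz with constant L, so the mollification is Lipschitz with constant
  L times the L^1 norm of f.\<close>

lemma continuous_on_mollify:
  fixes f :: "'a::euclidean_space \<Rightarrow> 'b::euclidean_space"
  assumes "d > 0" "integrable lborel f"
  shows "continuous_on S (mollify d f)"
proof -
  obtain L where L: "L > 0" "\<And>x y::'a. \<bar>mollifier d x - mollifier d y\<bar> \<le> L * norm (x - y)"
    using mollifier_bounds[OF assms(1), where 'a='a] by blast
  have [measurable]: "f \<in> borel_measurable borel" using assms by auto
  define B where "B = (\<integral>y. norm (f y) \<partial>lborel)"
  have "B \<ge> 0" by (simp add: B_def)
  have lip: "norm (mollify d f x - mollify d f x') \<le> L * B * norm (x - x')" for x x'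
  proof -
    have "norm (mollify d f x - mollify d f x') = norm (\<integral>y. (mollifier d (x - y) - mollifier d (x' - y)) *\<^sub>R f y \<partial>lborel)"
      unfolding mollify_def scaleR_diff_left
      by (subst Bochner_Integration.integral_diff) (auto intro!: integrable_mollify assms)
    also have "\<dots> \<le> (\<integral>y. (L * norm (x - x')) * norm (f y) \<partial>lborel)"
    proof (rule Bochner_Integration.integral_norm_bound_integral)
      show "integrable lborel (\<lambda>y. (mollifier d (x - y) - mollifier d (x' - y)) *\<^sub>R f y)"
        unfolding scaleR_diff_left by (intro Bochner_Integration.integrable_diff integrable_mollify assms)
      show "norm ((mollifier d (x - y) - mollifier d (x' - y)) *\<^sub>R f y) \<le> (L * norm (x - x')) * norm (f y)" for y
        using L(2)[of "x - y" "x' - y"] by (auto intro!: mult_right_mono)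
    qed (use assms in auto)
    also have "\<dots> = L * B * norm (x - x')" by (simp add: B_def)
    finally show ?thesis .
  qed
  have "(L * B)-lipschitz_on S (mollify d f)"
    using lip L(1) \<open>B \<ge> 0\<close> by (auto intro!: lipschitz_onI simp: dist_norm)
  then show ?thesis by (rule lipschitz_on_continuous_on)
qed

text \<open>The error is an average, with a probability density living on |h| < d, of the errors of
  translation by h; Tonelli allows integrating each of these in x before averaging.\<close>

lemma mollify_L1:
  fixes f :: "'a::euclidean_space \<Rightarrow> 'b::euclidean_space"
  assumes f: "integrable lborel f" and "e > 0"
  shows "\<exists>D>0. \<forall>d. 0 < d \<and> d < D \<longrightarrow> (\<integral>\<^sup>+x. norm (mollify d f x - f x) \<partial>lborel) \<le> ennreal e"
proof -
  have [measurable]: "f \<in> borel_measurable borel" using assms by auto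
  obtain D where D: "D > 0" "\<And>h. norm h < D \<Longrightarrow> (\<integral>\<^sup>+x. norm (f (h + x) - f x) \<partial>lborel) \<le> ennreal e"
    using L1_translation_continuous[OF assms] by blast
  have "(\<integral>\<^sup>+x. norm (mollify d f x - f x) \<partial>lborel) \<le> ennreal e" if d: "0 < d" "d < D" for d
  proof -
    \<comment> \<open>Since the kernel has mass 1, f x can be moved under the integral; then y = x +
      h is substituted, and evenness of the kernel removes the sign.\<close>
    have pt: "ennreal (norm (mollify d f x - f x)) \<le> (\<integral>\<^sup>+h. ennreal (mollifier d h) * ennreal (norm (f (h + x) - f x)) \<partial>lborel)" for x
    proof -
      have int1: "integrable lborel (\<lambda>y. mollifier d (x - y))"
        using integrable_lborel_translate[OF integrable_mollifier[OF d(1)], of "-x"]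
          mollifier_minus[of d "x - _"] by (simp add: algebra_simps)
      have one: "(\<integral>y. mollifier d (x - y) \<partial>lborel) = 1"
      proof -
        have "ennreal (\<integral>y. mollifier d (x - y) \<partial>lborel) = (\<integral>\<^sup>+y. mollifier d (x - y) \<partial>lborel)"
          by (intro nn_integral_eq_integral[symmetric] int1) (simp add: mollifier_nonneg)
        also have "\<dots> = (\<integral>\<^sup>+y. mollifier d (y::'a) \<partial>lborel)"
          using nn_integral_lborel_reflect[of "\<lambda>y::'a. ennreal (mollifier d y)" x] by simp
        finally show ?thesis by (simp add: nn_integral_mollifier d)
      qed
      have int2: "integrable lborel (\<lambda>y. mollifier d (x - y) *\<^sub>R f x)" using int1 by simp
      have "mollify d f x - f x = (\<integral>y. mollifier d (x - y) *\<^sub>R (f y - f x) \<partial>lborel)"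
        unfolding scaleR_diff_right mollify_def using one int1
        by (subst Bochner_Integration.integral_diff[OF integrable_mollify[OF d(1) f] int2]) simp
      moreover have "integrable lborel (\<lambda>y. mollifier d (x - y) *\<^sub>R (f y - f x))"
        unfolding scaleR_diff_right by (intro Bochner_Integration.integrable_diff integrable_mollify f d int2)
      ultimately have "ennreal (norm (mollify d f x - f x)) \<le> (\<integral>\<^sup>+y. norm (mollifier d (x - y) *\<^sub>R (f y - f x)) \<partial>lborel)"
        using integral_norm_bound_ennreal by metis
      also have "\<dots> = (\<integral>\<^sup>+h. norm (mollifier d (x - (x + h)) *\<^sub>R (f (x + h) - f x)) \<partial>lborel)"
        by (rule nn_integral_lborel_translate[symmetric]) simp
      also have "\<dots> = (\<integral>\<^sup>+h. ennreal (mollifier d h) * ennreal (norm (f (h + x) - f x)) \<partial>lborel)"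
        by (simp add: mollifier_nonneg mollifier_minus ennreal_mult add.commute)
      finally show ?thesis .
    qed
    have "(\<integral>\<^sup>+x. norm (mollify d f x - f x) \<partial>lborel)
        \<le> (\<integral>\<^sup>+x. \<integral>\<^sup>+h. ennreal (mollifier d h) * ennreal (norm (f (h + x) - f x)) \<partial>lborel \<partial>lborel)"
      by (intro nn_integral_mono pt)
    also have "\<dots> = (\<integral>\<^sup>+h. \<integral>\<^sup>+x. ennreal (mollifier d h) * ennreal (norm (f (h + x) - f x)) \<partial>lborel \<partial>lborel)"
      by (rule lborel_pair.Fubini') simp
    also have "\<dots> \<le> (\<integral>\<^sup>+h. ennreal (mollifier d (h::'a)) * ennreal e \<partial>lborel)"
    proof (rule nn_integral_mono)
      fix h :: 'a
      show "(\<integral>\<^sup>+x. ennreal (mollifier d h) * ennreal (norm (f (h + x) - f x)) \<partial>lborel) \<le> ennreal (mollifier d h) * ennreal e"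
      proof (cases "norm h < D")
        case True
        then show ?thesis
          by (simp add: nn_integral_cmult) (intro mult_left_mono D(2), auto)
      next
        case False
        then show ?thesis using d by (simp add: mollifier_eq_0)
      qed
    qed
    also have "\<dots> = ennreal e"
      by (simp add: nn_integral_multc nn_integral_mollifier d)
    finally show ?thesis .
  qed
  with D(1) show ?thesis by blast
qed

section \<open>Derivatives of mollified functions along lines\<close>

lemma has_real_derivative_integral:
  fixes f :: "real \<Rightarrow> 'a \<Rightarrow> real"
  assumes int: "\<And>t. integrable M (f t)"
    and deriv: "\<And>y. y \<in> space M \<Longrightarrow> ((\<lambda>t. f t y) has_real_derivative f' y) (at t)"
    and [measurable]: "f' \<in> borel_measurable M"
    and K: "integrable M K"
    and bound: "\<And>y s. y \<in> space M \<Longrightarrow> \<bar>f s y - f t y\<bar> \<le> K y * \<bar>s - t\<bar>"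
  shows "((\<lambda>t. \<integral>y. f t y \<partial>M) has_real_derivative (\<integral>y. f' y \<partial>M)) (at t)"
  unfolding DERIV_def tendsto_at_iff_sequentially comp_def
proof safe
  fix h :: "nat \<Rightarrow> real" assume h: "\<forall>i. h i \<in> UNIV - {0}" "h \<longlonglongrightarrow> 0"
  have [measurable]: "f s \<in> borel_measurable M" for s using int by auto
  have "(\<lambda>n. \<integral>y. (f (t + h n) y - f t y) / h n \<partial>M) \<longlonglongrightarrow> (\<integral>y. f' y \<partial>M)"
  proof (rule integral_dominated_convergence[OF _ _ K])
    show "AE y in M. (\<lambda>n. (f (t + h n) y - f t y) / h n) \<longlonglongrightarrow> f' y"
      using deriv h unfolding DERIV_def tendsto_at_iff_sequentially comp_def by auto
    show "AE y in M. norm ((f (t + h n) y - f t y) / h n) \<le> K y" for n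
    proof (rule AE_I2)
      fix y assume "y \<in> space M"
      with bound[of y "t + h n"] h show "norm ((f (t + h n) y - f t y) / h n) \<le> K y"
        by (simp add: divide_le_eq)
    qed
  qed measurable
  also have "(\<lambda>n. \<integral>y. (f (t + h n) y - f t y) / h n \<partial>M) = (\<lambda>n. ((\<integral>y. f (t + h n) y \<partial>M) - (\<integral>y. f t y \<partial>M)) / h n)"
    by (simp add: Bochner_Integration.integral_diff int)
  finally show "(\<lambda>n. ((\<integral>y. f (t + h n) y \<partial>M) - (\<integral>y. f t y \<partial>M)) / h n) \<longlonglongrightarrow> (\<integral>y. f' y \<partial>M)" .
qed

text \<open>The derivative first falls on the kernel. Since the closed ball of radius d about the
  point lies in S, the kernel centred there is a test function, and the weak identity moves the
  derivative over to U. Directional derivatives are enough, as the mollification is only ever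
  differentiated along segments.\<close>

lemma mollify_line_derivative:
  fixes U :: "'a::euclidean_space \<Rightarrow> real" and G :: "'a \<Rightarrow> 'a"
  assumes U: "integrable lborel U" and G: "integrable lborel G" and "d > 0"
    and weak: "\<And>\<phi> b. \<phi> \<in> test_functions S \<Longrightarrow> b \<in> Basis \<Longrightarrow>
      (\<integral>y. U y * frechet_derivative \<phi> (at y) b \<partial>lborel) = - (\<integral>y. (G y \<bullet> b) * \<phi> y \<partial>lborel)"
    and S: "cball (x + t *\<^sub>R v) d \<subseteq> S"
  shows "((\<lambda>s. mollify d U (x + s *\<^sub>R v)) has_real_derivative mollify d G (x + t *\<^sub>R v) \<bullet> v) (at t)"
proof -
  define a where "a = x + t *\<^sub>R v"
  define m where "m = (\<integral>y. bump 0 d (y::'a) \<partial>lborel)"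
  have m: "m > 0" unfolding m_def by (rule integral_bump_pos[OF assms(3)])
  have [measurable]: "U \<in> borel_measurable borel" "G \<in> borel_measurable borel" using U G by auto
  obtain L where L: "L > 0" "\<And>x y::'a. \<bar>mollifier d x - mollifier d y\<bar> \<le> L * norm (x - y)"
    using mollifier_bounds[OF assms(3), where 'a='a] by blast
  \<comment> \<open>This is the derivative of the bump with respect to its centre, the negative of
    its derivative in y; the sign cancels the one in the weak identity.\<close>
  define D where "D y h = 2 * bump 2 d (y - a) * ((y - a) \<bullet> h)" for y h
  have "((\<lambda>s. \<integral>y. mollifier d (x + s *\<^sub>R v - y) * U y \<partial>lborel) has_real_derivative
      (\<integral>y. D y v / m * U y \<partial>lborel)) (at t)"
  proof (rule has_real_derivative_integral)
    show "integrable lborel (\<lambda>y. mollifier d (x + s *\<^sub>R v - y) * U y)" for s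
      using integrable_mollify[OF assms(3) U] by simp
    show "integrable lborel (\<lambda>y. L * norm v * \<bar>U y\<bar>)" using U by simp
    show "\<bar>mollifier d (x + s *\<^sub>R v - y) * U y - mollifier d (x + t *\<^sub>R v - y) * U y\<bar>
        \<le> L * norm v * \<bar>U y\<bar> * \<bar>s - t\<bar>" for y s
    proof -
      have "\<bar>mollifier d (x + s *\<^sub>R v - y) * U y - mollifier d (x + t *\<^sub>R v - y) * U y\<bar>
        = \<bar>mollifier d (x + s *\<^sub>R v - y) - mollifier d (x + t *\<^sub>R v - y)\<bar> * \<bar>U y\<bar>"
        by (simp add: abs_mult[symmetric] left_diff_distrib)
      also have "\<dots> \<le> L * norm ((s - t) *\<^sub>R v) * \<bar>U y\<bar>"
        using L(2)[of "x + s *\<^sub>R v - y" "x + t *\<^sub>R v - y"]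
        by (intro mult_right_mono) (auto simp: scaleR_diff_left)
      finally show ?thesis by (simp add: mult_ac)
    qed
    show "((\<lambda>s. mollifier d (x + s *\<^sub>R v - y) * U y) has_real_derivative D y v / m * U y) (at t)" for y
    proof -
      have 1: "((\<lambda>s. x + s *\<^sub>R v) has_derivative (\<lambda>s. s *\<^sub>R v)) (at t)"
        by (auto intro!: derivative_eq_intros)
      have "((\<lambda>s. bump 0 d (x + s *\<^sub>R v - y)) has_derivative (\<lambda>s. D y v * s)) (at t)"
        using has_derivative_compose[OF 1 has_derivative_bump[of 0 d y "x + t *\<^sub>R v"]] bump_minus[of 2 d "y - a"]
        by (simp add: D_def a_def numeral_2_eq_2 algebra_simps inner_diff_left)
      then have "((\<lambda>s. bump 0 d (x + s *\<^sub>R v - y)) has_real_derivative D y v) (at t)"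
        by (simp add: has_field_derivative_def)
      then show ?thesis
        using m unfolding mollifier_def m_def[symmetric] by (auto intro!: derivative_eq_intros)
    qed
    show "(\<lambda>y. D y v / m * U y) \<in> borel_measurable lborel" unfolding D_def by measurable
  qed
  moreover have "(\<integral>y. D y v / m * U y \<partial>lborel) = mollify d G a \<bullet> v"
  proof -
    have intD: "integrable lborel (\<lambda>y. D y h * U y)" for h
    proof (rule Bochner_Integration.integrable_bound)
      show "integrable lborel (\<lambda>y. 4 * d * norm h * norm (U y))" using U by simp
      show "AE y in lborel. norm (D y h * U y) \<le> norm (4 * d * norm h * norm (U y))"
      proof (rule AE_I2)
        fix y
        have "norm (D y h * U y) \<le> 4 * d * norm h * norm (U y)"
          using mult_right_mono[OF bump_gradient_le[OF assms(3), of "y - a" h] abs_ge_zero[of "U y"]]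
          unfolding D_def real_norm_def abs_mult[of _ "U y"] .
        then show "norm (D y h * U y) \<le> norm (4 * d * norm h * norm (U y))" by simp
      qed
    qed (auto simp: D_def)
    have intG: "integrable lborel (\<lambda>y. mollifier d (a - y) *\<^sub>R G y)"
      by (rule integrable_mollify[OF assms(3) G])
    have b: "(\<integral>y. D y b * U y \<partial>lborel) = m * (mollify d G a \<bullet> b)" if b: "b \<in> Basis" for b
    proof -
      have "(\<integral>y. D y b * U y \<partial>lborel) = - (\<integral>y. U y * frechet_derivative (\<lambda>y. bump 0 d (y - a)) (at y) b \<partial>lborel)"
        unfolding frechet_derivative_bump by (simp add: D_def mult_ac)
      also have "\<dots> = (\<integral>y. (G y \<bullet> b) * bump 0 d (y - a) \<partial>lborel)"
        using weak[OF bump_test_function[OF assms(3), of a S 0] b] S by (simp add: a_def)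
      also have "\<dots> = (\<integral>y. m * ((mollifier d (a - y) *\<^sub>R G y) \<bullet> b) \<partial>lborel)"
        using bump_minus[of 0 d "_ - a"] m
        by (intro Bochner_Integration.integral_cong refl) (simp add: mollifier_def m_def[symmetric])
      also have "\<dots> = m * (mollify d G a \<bullet> b)"
        using integral_inner_left[of b lborel "\<lambda>y. mollifier d (a - y) *\<^sub>R G y"] intG
        by (simp add: mollify_def)
      finally show ?thesis .
    qed
    \<comment> \<open>The weak identity speaks of basis directions only; linearity of D in its
      direction extends it to v.\<close>
    have "D y v = (\<Sum>b\<in>Basis. (v \<bullet> b) * D y b)" for y
    proof -
      have "(y - a) \<bullet> v = (\<Sum>b\<in>Basis. (v \<bullet> b) * ((y - a) \<bullet> b))"
        by (subst euclidean_inner) (simp add: mult.commute)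
      then show ?thesis by (simp add: D_def sum_distrib_left mult_ac)
    qed
    then have "(\<integral>y. D y v / m * U y \<partial>lborel) = (\<integral>y. (\<Sum>b\<in>Basis. (v \<bullet> b) / m * (D y b * U y)) \<partial>lborel)"
      by (simp add: sum_divide_distrib sum_distrib_right sum_distrib_left mult_ac)
    also have "\<dots> = (\<Sum>b\<in>Basis. (v \<bullet> b) / m * (\<integral>y. D y b * U y \<partial>lborel))"
      by (subst Bochner_Integration.integral_sum) (use intD in \<open>auto simp del: integral_mult_right_zero\<close>)
    also have "\<dots> = (\<Sum>b\<in>Basis. (v \<bullet> b) * (mollify d G a \<bullet> b))"
      using m by (simp add: b)
    also have "\<dots> = mollify d G a \<bullet> v"
      by (subst (2) euclidean_inner) (simp add: mult.commute)
    finally show ?thesis .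
  qed
  ultimately show ?thesis by (simp add: mollify_def a_def)
qed

section \<open>The weight averaged over segments\<close>

text \<open>The closed ball of the maximum norm. Unlike the Euclidean ball, it lets the integral of
  the weight split into one-dimensional factors.\<close>

definition cube :: "real \<Rightarrow> 'a::euclidean_space set" where
  "cube r = cbox (- (\<Sum>b\<in>Basis. r *\<^sub>R b)) (\<Sum>b\<in>Basis. r *\<^sub>R b)"

lemma mem_cube: "x \<in> cube r \<longleftrightarrow> (\<forall>b\<in>Basis. \<bar>x \<bullet> b\<bar> \<le> r)"
  by (auto simp: cube_def mem_box abs_le_iff)

lemma ball_subset_cube: "ball 0 r \<subseteq> cube r"
  by (auto simp: mem_cube) (meson Basis_le_norm less_imp_le order_trans)

lemma ball_borel [measurable]: "ball a r \<in> sets borel"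
  by simp

lemma cube_borel [measurable]: "cube r \<in> sets borel"
  by (simp add: cube_def)

text \<open>The interval is folded onto its positive half, where p > -1 is integrability at
  0.\<close>

lemma nn_integral_powr_interval:
  assumes "p > -1" "r > 0"
  shows "(\<integral>\<^sup>+s. ennreal (indicator {-r..r} s * \<bar>s\<bar> powr p) \<partial>lborel) \<le> ennreal (2 * (r powr (p + 1) / (p + 1)))"
proof -
  define F where "F = (\<lambda>s. ennreal (indicator {0..r} s * s powr p))"
  have [measurable]: "F \<in> borel_measurable borel" unfolding F_def by measurable
  have "((\<lambda>s. s powr p) has_integral (r powr (p + 1) / (p + 1))) {0..r}"
    using has_integral_powr_from_0[of p r] assms by auto
  then have half: "(\<integral>\<^sup>+s. F s \<partial>lborel) = ennreal (r powr (p + 1) / (p + 1))"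
    unfolding F_def by (intro nn_integral_has_integral_lebesgue) auto
  have "(\<integral>\<^sup>+s. ennreal (indicator {-r..r} s * \<bar>s\<bar> powr p) \<partial>lborel) \<le> (\<integral>\<^sup>+s. F s + F (0 - s) \<partial>lborel)"
    by (intro nn_integral_mono) (auto simp: F_def indicator_def)
  also have "\<dots> = ennreal (r powr (p + 1) / (p + 1)) + ennreal (r powr (p + 1) / (p + 1))"
    by (subst nn_integral_add) (simp_all add: half nn_integral_lborel_reflect[of F 0, simplified])
  also have "\<dots> = ennreal (2 * (r powr (p + 1) / (p + 1)))"
    using assms by (simp flip: ennreal_plus)
  finally show ?thesis .
qed

lemma nn_integral_powr_cube:
  fixes e :: "'a::euclidean_space"
  assumes "p > -1" "e \<in> Basis"
  shows "\<exists>J>0. \<forall>r>0. (\<integral>\<^sup>+x. ennreal (indicator (cube r) x * \<bar>x \<bullet> e\<bar> powr p) \<partial>lborel)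
    \<le> ennreal (J * r powr (real DIM('a) + p))"
proof -
  \<comment> \<open>The axis e contributes 2 / (p + 1), each of the remaining axes a factor
    2.\<close>
  define J :: real where "J = 2 / (p + 1) * 2 ^ (DIM('a) - 1)"
  have "J > 0" using assms by (simp add: J_def)
  moreover have "(\<integral>\<^sup>+x. ennreal (indicator (cube r) x * \<bar>x \<bullet> e\<bar> powr p) \<partial>lborel)
      \<le> ennreal (J * r powr (real DIM('a) + p))" if "r > 0" for r
  proof -
    define f where "f b s = (indicator {-r..r} s * (if b = e then \<bar>s\<bar> powr p else 1) :: real)" for b :: 'a and s
    have "(\<integral>\<^sup>+x. ennreal (indicator (cube r) x * \<bar>x \<bullet> e\<bar> powr p) \<partial>lborel)
        = (\<integral>\<^sup>+x. ennreal (\<Prod>b\<in>Basis. f b (x \<bullet> b)) \<partial>lborel)"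
    proof (intro nn_integral_cong arg_cong[of _ _ ennreal])
      fix x :: 'a
      have "(\<Prod>b\<in>Basis. f b (x \<bullet> b)) = (\<Prod>b\<in>Basis. indicator {-r..r} (x \<bullet> b)) * (\<Prod>b\<in>Basis. if b = e then \<bar>x \<bullet> b\<bar> powr p else 1)"
        by (simp add: f_def prod.distrib)
      also have "(\<Prod>b\<in>Basis. if b = e then \<bar>x \<bullet> b\<bar> powr p else 1) = \<bar>x \<bullet> e\<bar> powr p"
        using assms by (subst prod.delta) auto
      also have "(\<Prod>b\<in>Basis. indicator {-r..r} (x \<bullet> b)) = (indicator (cube r) x :: real)"
      proof (cases "x \<in> cube r")
        case True
        then have "-r \<le> x \<bullet> b \<and> x \<bullet> b \<le> r" if "b \<in> Basis" for b
          using that unfolding mem_cube by (metis abs_le_D1 abs_le_D2 minus_le_iff)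
        with True show ?thesis by (auto simp: indicator_def intro!: prod.neutral)
      next
        case False
        then obtain b where "b \<in> Basis" "x \<bullet> b \<notin> {-r..r}"
          by (auto simp: mem_cube abs_le_iff)
        with False show ?thesis by (auto simp: indicator_def intro!: prod_zero bexI[of _ b])
      qed
      finally show "indicator (cube r) x * \<bar>x \<bullet> e\<bar> powr p = (\<Prod>b\<in>Basis. f b (x \<bullet> b))" by simp
    qed
    also have "\<dots> = (\<Prod>b\<in>Basis. \<integral>\<^sup>+s. ennreal (f b s) \<partial>lborel)"
      by (subst nn_integral_lborel_prod[symmetric]) (auto simp: f_def prod_ennreal)
    also have "\<dots> \<le> (\<Prod>b\<in>Basis. ennreal (if b = e then 2 * (r powr (p + 1) / (p + 1)) else 2 * r))"
    proof (rule prod_mono_ennreal)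
      fix b :: 'a
      show "(\<integral>\<^sup>+s. ennreal (f b s) \<partial>lborel) \<le> ennreal (if b = e then 2 * (r powr (p + 1) / (p + 1)) else 2 * r)"
        using nn_integral_powr_interval[OF assms(1) that] that by (simp add: f_def ennreal_indicator)
    qed
    also have "\<dots> = ennreal (\<Prod>b\<in>(Basis::'a set). if b = e then 2 * (r powr (p + 1) / (p + 1)) else 2 * r)"
      using that assms by (intro prod_ennreal) auto
    also have "(\<Prod>b\<in>(Basis::'a set). if b = e then 2 * (r powr (p + 1) / (p + 1)) else 2 * r)
        = 2 * (r powr (p + 1) / (p + 1)) * (2 * r) ^ (DIM('a) - 1)"
      using assms by (subst prod.remove[of _ e]) (auto simp: card_Diff_singleton)
    also have "\<dots> = J * r powr (real DIM('a) + p)"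
    proof -
      \<comment> \<open>Writing the dimension as a successor turns the natural-number subtraction in
        the exponent into the real exponent n + p = (p + 1) + N.\<close>
      obtain N where N: "DIM('a) = Suc N" using DIM_positive[where 'a='a] gr0_conv_Suc by blast
      have "r powr (real DIM('a) + p) = r powr (p + 1) * r powr real N"
        by (simp add: N powr_add[symmetric] algebra_simps)
      then show ?thesis using that by (simp add: J_def N powr_realpow power_mult_distrib)
    qed
    finally show ?thesis .
  qed
  ultimately show ?thesis by blast
qed

lemma emeasure_cube:
  assumes "r > 0"
  shows "emeasure lborel (cube r :: 'a::euclidean_space set) = ennreal (2 ^ DIM('a) * r powr real DIM('a))"
proof -
  have "emeasure lborel (cube r :: 'a set) = ennreal (\<Prod>b\<in>(Basis::'a set). 2 * r)"
    unfolding cube_def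
  proof (subst emeasure_lborel_cbox)
    show "ennreal (prod ((\<bullet>) ((\<Sum>b\<in>Basis. r *\<^sub>R b) - - (\<Sum>b\<in>Basis. r *\<^sub>R b))) (Basis::'a set)) = ennreal (\<Prod>b\<in>(Basis::'a set). 2 * r)"
      by (intro arg_cong[of _ _ ennreal] prod.cong refl) (simp add: inner_add_left)
  qed (use assms in simp)
  then show ?thesis using assms by (simp add: powr_realpow power_mult_distrib)
qed

text \<open>The change of variables costs c^(-n), which is at most 2^n because c is at least
  1/2.\<close>

lemma nn_integral_affine_le:
  fixes a :: "'a::euclidean_space" and f :: "'a \<Rightarrow> ennreal"
  assumes c: "1/2 \<le> c" "c \<le> 1" and [measurable]: "f \<in> borel_measurable borel"
  shows "(\<integral>\<^sup>+x. f (a + c *\<^sub>R x) \<partial>lborel) \<le> ennreal (2 ^ DIM('a)) * (\<integral>\<^sup>+x. f x \<partial>lborel)"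
proof -
  have "1 \<le> 2 ^ DIM('a) * c ^ DIM('a)"
    using one_le_power[of "2 * c" "DIM('a)"] c unfolding power_mult_distrib by simp
  then have "1 * (\<integral>\<^sup>+x. f (a + c *\<^sub>R x) \<partial>lborel) \<le> ennreal (2 ^ DIM('a) * c ^ DIM('a)) * (\<integral>\<^sup>+x. f (a + c *\<^sub>R x) \<partial>lborel)"
    by (intro mult_right_mono) (auto intro: ennreal_leI[of 1, simplified])
  also have "\<dots> = ennreal (2 ^ DIM('a)) * (\<integral>\<^sup>+x. f x \<partial>lborel)"
    using c by (subst nn_integral_lborel_affine[of c f a]) (auto simp: ennreal_mult mult.assoc)
  finally show ?thesis by simp
qed

text \<open>For \<open>p < 0\<close> the singular set of the weight, seen from \<open>z\<close>, moves with speed \<open>t\<close>;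
  this produces the factor \<open>t powr p\<close>, still integrable at \<open>0\<close>.\<close>

lemma weight_average_bound:
  fixes e :: "'a::euclidean_space"
  assumes "e \<in> Basis" "r > 0" "0 < t" "t < 1" "J > 0"
    and J: "(\<integral>\<^sup>+x. ennreal (indicator (cube r) x * \<bar>x \<bullet> e\<bar> powr p) \<partial>lborel) \<le> ennreal (J * r powr (real DIM('a) + p))"
  shows "(\<integral>\<^sup>+z. ennreal (indicator (ball 0 r) z * (indicator (ball 0 r) ((1 / (1 - t)) *\<^sub>R (y - t *\<^sub>R z)) *
      \<bar>((1 / (1 - t)) *\<^sub>R (y - t *\<^sub>R z)) \<bullet> e\<bar> powr p)) \<partial>lborel)
    \<le> ennreal ((J + 2 ^ DIM('a)) * r powr (real DIM('a) + p) * (1 + t powr p))" (is "?L \<le> _")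
proof -
  have ballW: "(\<integral>\<^sup>+z. ennreal (r powr p * indicator (ball a r) z) \<partial>lborel) \<le> ennreal (2 ^ DIM('a) * r powr (real DIM('a) + p))" for a :: 'a
  proof -
    have "(\<integral>\<^sup>+z. ennreal (r powr p * indicator (ball a r) z) \<partial>lborel) = ennreal (r powr p) * emeasure lborel (ball a r)"
      by (simp add: ennreal_mult nn_integral_cmult_indicator ennreal_indicator)
    also have "emeasure lborel (ball a r) = emeasure lborel (ball (0::'a) r)"
    proof -
      have "emeasure lborel (ball a r) = (\<integral>\<^sup>+x. indicator (ball a r) x \<partial>lborel)" by simp
      also have "\<dots> = (\<integral>\<^sup>+x. indicator (ball a r) (a + x) \<partial>lborel)"
        by (rule nn_integral_lborel_translate[symmetric]) (intro borel_measurable_indicator, simp)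
      also have "(\<lambda>x. indicator (ball a r) (a + x) :: ennreal) = indicator (ball 0 r)"
        by (auto simp: fun_eq_iff indicator_def dist_norm)
      finally show ?thesis by simp
    qed
    also have "\<dots> \<le> ennreal (2 ^ DIM('a) * r powr real DIM('a))"
      unfolding emeasure_cube[OF \<open>r > 0\<close>, symmetric] by (intro emeasure_mono ball_subset_cube) simp
    finally have "(\<integral>\<^sup>+z. ennreal (r powr p * indicator (ball a r) z) \<partial>lborel)
        \<le> ennreal (r powr p) * ennreal (2 ^ DIM('a) * r powr real DIM('a))"
      by (simp add: mult_left_mono)
    also have "\<dots> = ennreal (2 ^ DIM('a) * r powr (real DIM('a) + p))"
      by (simp add: powr_add ennreal_mult[symmetric] mult_ac)
    finally show ?thesis .
  qed
  show ?thesis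
  proof (cases "p \<ge> 0")
    case True
    have "?L \<le> (\<integral>\<^sup>+z. ennreal (r powr p * indicator (ball (0::'a) r) z) \<partial>lborel)"
    proof (intro nn_integral_mono ennreal_leI)
      fix z :: 'a
      define x where "x = (1 / (1 - t)) *\<^sub>R (y - t *\<^sub>R z)"
      have "indicator (ball 0 r) x * \<bar>x \<bullet> e\<bar> powr p \<le> r powr p"
      proof (cases "x \<in> ball 0 r")
        case 1: True
        then have "\<bar>x \<bullet> e\<bar> \<le> r" using Basis_le_norm[OF assms(1), of x] by auto
        then show ?thesis using True 1 by (simp add: powr_mono2)
      qed simp
      then show "indicator (ball 0 r) z * (indicator (ball 0 r) x * \<bar>x \<bullet> e\<bar> powr p) \<le> r powr p * indicator (ball (0::'a) r) z"
        by (simp add: indicator_def)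
    qed
    also note ballW
    also have "ennreal (2 ^ DIM('a) * r powr (real DIM('a) + p)) \<le>
        ennreal ((J + 2 ^ DIM('a)) * r powr (real DIM('a) + p) * (1 + t powr p))"
      using assms by (intro ennreal_leI) (simp add: algebra_simps add_nonneg_nonneg)
    finally show ?thesis .
  next
    case False
    \<comment> \<open>Seen as a function of z, the weight is singular on the hyperplane where z
      \<bullet> e equals this value, because \<bar>x \<bullet> e\<bar> = t \<bar>c - z \<bullet>
      e\<bar> / (1 - t).\<close>
    define c where "c = y \<bullet> e / t"
    define Q where "Q = (\<lambda>z::'a. ennreal (indicator (ball 0 r) z * \<bar>c - z \<bullet> e\<bar> powr p))"
    have [measurable]: "Q \<in> borel_measurable borel" unfolding Q_def by measurable
    have "?L \<le> (\<integral>\<^sup>+z. ennreal (t powr p) * Q z \<partial>lborel)"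
    proof (rule nn_integral_mono)
      fix z :: 'a
      define x where "x = (1 / (1 - t)) *\<^sub>R (y - t *\<^sub>R z)"
      have x: "\<bar>x \<bullet> e\<bar> = t * \<bar>c - z \<bullet> e\<bar> / (1 - t)"
      proof -
        have "t * (c - z \<bullet> e) = y \<bullet> e - t * (z \<bullet> e)"
          using assms by (simp add: c_def right_diff_distrib)
        then have "x \<bullet> e = t * (c - z \<bullet> e) / (1 - t)"
          by (simp add: x_def inner_diff_left)
        then show ?thesis using assms by (simp add: abs_mult)
      qed
      \<comment> \<open>Dropping the denominator 1 - t < 1 decreases the base, and p is negative
        here. On the singular hyperplane itself both sides are 0, as \<open>0 powr p\<close> is
        0.\<close>
      have "\<bar>x \<bullet> e\<bar> powr p \<le> (t * \<bar>c - z \<bullet> e\<bar>) powr p"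
      proof (cases "c - z \<bullet> e = 0")
        case 0: False
        then show ?thesis using assms False unfolding x
          by (intro powr_mono2') (auto simp: field_simps)
      qed (simp add: x)
      also have "\<dots> = t powr p * \<bar>c - z \<bullet> e\<bar> powr p" using assms by (simp add: powr_mult)
      finally have "indicator (ball 0 r) z * (indicator (ball 0 r) x * \<bar>x \<bullet> e\<bar> powr p)
          \<le> t powr p * (indicator (ball 0 r) z * \<bar>c - z \<bullet> e\<bar> powr p)"
        by (simp add: indicator_def)
      then show "ennreal (indicator (ball 0 r) z * (indicator (ball 0 r) x * \<bar>x \<bullet> e\<bar> powr p)) \<le> ennreal (t powr p) * Q z"
        by (simp add: Q_def ennreal_mult[symmetric] ennreal_leI)
    qed
    also have "\<dots> = ennreal (t powr p) * (\<integral>\<^sup>+z. Q z \<partial>lborel)"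
      by (rule nn_integral_cmult) simp
    \<comment> \<open>The reflection puts the singularity at z \<bullet> e = 0 and moves the ball to
      the centre c e, which may be far away.\<close>
    also have "(\<integral>\<^sup>+z. Q z \<partial>lborel) = (\<integral>\<^sup>+z. Q (c *\<^sub>R e - z) \<partial>lborel)"
      by (rule nn_integral_lborel_reflect[symmetric]) simp
    \<comment> \<open>Where \<bar>z \<bullet> e\<bar> \<le> r, the point lies in the cube about the
      origin, since its other coordinates are those of a point in a ball of radius r centred on the
      axis. Elsewhere the weight is at most r^p. Neither bound depends on c.\<close>
    also have "\<dots> \<le> (\<integral>\<^sup>+z. ennreal (indicator (cube r) z * \<bar>z \<bullet> e\<bar> powr p) + ennreal (r powr p * indicator (ball (c *\<^sub>R e) r) z) \<partial>lborel)"
    proof (rule nn_integral_mono)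
      fix z :: 'a
      have "z \<in> cube r" if "norm (c *\<^sub>R e - z) < r" "\<bar>z \<bullet> e\<bar> \<le> r"
        unfolding mem_cube
      proof
        fix b :: 'a assume b: "b \<in> Basis"
        show "\<bar>z \<bullet> b\<bar> \<le> r"
        proof (cases "b = e")
          case False
          then have "(c *\<^sub>R e - z) \<bullet> b = - (z \<bullet> b)"
            using b assms by (simp add: inner_diff_left inner_Basis)
          then show ?thesis using Basis_le_norm[OF b, of "c *\<^sub>R e - z"] that by simp
        qed (use that in simp)
      qed
      moreover have "\<bar>z \<bullet> e\<bar> powr p \<le> r powr p" if "\<not> \<bar>z \<bullet> e\<bar> \<le> r"
        using that False assms by (intro powr_mono2') auto
      ultimately have "indicator (ball 0 r) (c *\<^sub>R e - z) * \<bar>z \<bullet> e\<bar> powr p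
        \<le> indicator (cube r) z * \<bar>z \<bullet> e\<bar> powr p + r powr p * indicator (ball (c *\<^sub>R e) r) z"
        using norm_minus_commute[of "c *\<^sub>R e" z] by (auto simp: indicator_def dist_norm)
      then show "Q (c *\<^sub>R e - z) \<le> ennreal (indicator (cube r) z * \<bar>z \<bullet> e\<bar> powr p) + ennreal (r powr p * indicator (ball (c *\<^sub>R e) r) z)"
        using assms by (simp add: Q_def inner_diff_left inner_Basis ennreal_leI flip: ennreal_plus)
    qed
    also have "\<dots> = (\<integral>\<^sup>+z. ennreal (indicator (cube r) z * \<bar>z \<bullet> e\<bar> powr p) \<partial>lborel) + (\<integral>\<^sup>+z. ennreal (r powr p * indicator (ball (c *\<^sub>R e) r) z) \<partial>lborel)"
      by (rule nn_integral_add) auto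
    also have "\<dots> \<le> ennreal (J * r powr (real DIM('a) + p)) + ennreal (2 ^ DIM('a) * r powr (real DIM('a) + p))"
      by (intro add_mono J ballW)
    also have "\<dots> = ennreal ((J + 2 ^ DIM('a)) * r powr (real DIM('a) + p))"
      using assms by (simp add: algebra_simps flip: ennreal_plus)
    finally have "?L \<le> ennreal (t powr p) * ennreal ((J + 2 ^ DIM('a)) * r powr (real DIM('a) + p))"
      by (simp add: mult_left_mono)
    also have "\<dots> = ennreal (t powr p * ((J + 2 ^ DIM('a)) * r powr (real DIM('a) + p)))"
      using assms by (intro ennreal_mult[symmetric]) auto
    also have "\<dots> \<le> ennreal ((J + 2 ^ DIM('a)) * r powr (real DIM('a) + p) * (1 + t powr p))"
      using assms by (intro ennreal_leI) (simp add: algebra_simps add_nonneg_nonneg)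
    finally show ?thesis .
  qed
qed

text \<open>The substitution has Jacobian (1 - t)^n when z is fixed and t^n when x is fixed.
  Switching at t = 1/2 keeps the base at least 1/2 in both cases.\<close>

lemma segment_weight_bound_at:
  fixes e :: "'a::euclidean_space" and H :: "'a \<Rightarrow> ennreal"
  assumes "e \<in> Basis" "r > 0" "0 < t" "t < 1" "J > 0"
    and J: "(\<integral>\<^sup>+x. ennreal (indicator (cube r) x * \<bar>x \<bullet> e\<bar> powr p) \<partial>lborel) \<le> ennreal (J * r powr (real DIM('a) + p))"
    and [measurable]: "H \<in> borel_measurable borel"
  defines "b \<equiv> (\<lambda>x. indicator (ball (0::'a) r) x :: real)"
  shows "(\<integral>\<^sup>+x. \<integral>\<^sup>+z. ennreal (b z * (b x * \<bar>x \<bullet> e\<bar> powr p)) * H (x + t *\<^sub>R (z - x)) \<partial>lborel \<partial>lborel)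
    \<le> ennreal (2 ^ DIM('a) * ((J + 2 ^ DIM('a)) * r powr (real DIM('a) + p) * (1 + t powr p))) * (\<integral>\<^sup>+x. H x \<partial>lborel)"
    (is "?L \<le> ennreal (_ * ?M) * ?I")
proof -
  define W where "W x = b x * \<bar>x \<bullet> e\<bar> powr p" for x
  have [measurable]: "b \<in> borel_measurable borel"
    unfolding b_def by (intro borel_measurable_indicator) simp
  have [measurable]: "W \<in> borel_measurable borel"
    unfolding W_def by measurable
  have b0: "b x \<ge> 0" "b x \<le> 1" and W0: "W x \<ge> 0" for x by (auto simp: b_def W_def)
  have Mpos: "?M \<ge> 0" using assms by (auto intro!: mult_nonneg_nonneg add_nonneg_nonneg)
  have "?L \<le> ennreal (2 ^ DIM('a)) * ennreal ?M * ?I"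
  proof (cases "t \<le> 1/2")
    case True
    have "?L = (\<integral>\<^sup>+z. \<integral>\<^sup>+x. ennreal (b z * W x) * H (x + t *\<^sub>R (z - x)) \<partial>lborel \<partial>lborel)"
      unfolding W_def[symmetric] by (rule lborel_pair.Fubini') simp
    \<comment> \<open>With y = (1 - t) x + t z as the new variable, x becomes (y - t z) / (1 - t);
      after exchanging integrals, the inner one is the average of the weight over z.\<close>
    also have "\<dots> \<le> (\<integral>\<^sup>+z. ennreal (2 ^ DIM('a)) * (\<integral>\<^sup>+y. ennreal (b z * W ((1 / (1 - t)) *\<^sub>R (y - t *\<^sub>R z))) * H y \<partial>lborel) \<partial>lborel)"
    proof (rule nn_integral_mono)
      fix z :: 'a
      have "(\<integral>\<^sup>+x. ennreal (b z * W x) * H (x + t *\<^sub>R (z - x)) \<partial>lborel)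
        = (\<integral>\<^sup>+x. (\<lambda>y. ennreal (b z * W ((1 / (1 - t)) *\<^sub>R (y - t *\<^sub>R z))) * H y) (t *\<^sub>R z + (1 - t) *\<^sub>R x) \<partial>lborel)"
      proof (rule nn_integral_cong)
        fix x :: 'a
        have "(1 / (1 - t)) *\<^sub>R (t *\<^sub>R z + (1 - t) *\<^sub>R x - t *\<^sub>R z) = x"
          using assms by simp
        moreover have "x + t *\<^sub>R (z - x) = t *\<^sub>R z + (1 - t) *\<^sub>R x"
          by (simp add: algebra_simps)
        ultimately show "ennreal (b z * W x) * H (x + t *\<^sub>R (z - x)) =
            (\<lambda>y. ennreal (b z * W ((1 / (1 - t)) *\<^sub>R (y - t *\<^sub>R z))) * H y) (t *\<^sub>R z + (1 - t) *\<^sub>R x)"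
          by simp
      qed
      also have "\<dots> \<le> ennreal (2 ^ DIM('a)) * (\<integral>\<^sup>+y. ennreal (b z * W ((1 / (1 - t)) *\<^sub>R (y - t *\<^sub>R z))) * H y \<partial>lborel)"
        using assms True by (intro nn_integral_affine_le) auto
      finally show "(\<integral>\<^sup>+x. ennreal (b z * W x) * H (x + t *\<^sub>R (z - x)) \<partial>lborel) \<le> \<dots>" .
    qed
    also have "\<dots> = ennreal (2 ^ DIM('a)) * (\<integral>\<^sup>+z. \<integral>\<^sup>+y. ennreal (b z * W ((1 / (1 - t)) *\<^sub>R (y - t *\<^sub>R z))) * H y \<partial>lborel \<partial>lborel)"
      by (rule nn_integral_cmult) simp
    also have "(\<integral>\<^sup>+z. \<integral>\<^sup>+y. ennreal (b z * W ((1 / (1 - t)) *\<^sub>R (y - t *\<^sub>R z))) * H y \<partial>lborel \<partial>lborel)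
        = (\<integral>\<^sup>+y. \<integral>\<^sup>+z. ennreal (b z * W ((1 / (1 - t)) *\<^sub>R (y - t *\<^sub>R z))) * H y \<partial>lborel \<partial>lborel)"
      by (rule lborel_pair.Fubini') simp
    also have "\<dots> \<le> (\<integral>\<^sup>+y. ennreal ?M * H y \<partial>lborel)"
    proof (rule nn_integral_mono)
      fix y :: 'a
      have "(\<integral>\<^sup>+z. ennreal (b z * W ((1 / (1 - t)) *\<^sub>R (y - t *\<^sub>R z))) * H y \<partial>lborel)
          = (\<integral>\<^sup>+z. ennreal (b z * W ((1 / (1 - t)) *\<^sub>R (y - t *\<^sub>R z))) \<partial>lborel) * H y"
        by (rule nn_integral_multc) simp
      also have "\<dots> \<le> ennreal ?M * H y"
        using weight_average_bound[OF assms(1-6), of y] unfolding W_def b_def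
        by (intro mult_right_mono) auto
      finally show "(\<integral>\<^sup>+z. ennreal (b z * W ((1 / (1 - t)) *\<^sub>R (y - t *\<^sub>R z))) * H y \<partial>lborel) \<le> ennreal ?M * H y" .
    qed
    also have "\<dots> = ennreal ?M * ?I" by (rule nn_integral_cmult) simp
    finally show ?thesis by (simp add: mult_left_mono mult.assoc)
  next
    case False
    \<comment> \<open>The cutoff in z is dropped: the integral of H over the whole space no longer
      sees x, and the weight is integrated by itself.\<close>
    have "?L \<le> (\<integral>\<^sup>+x. ennreal (W x) * (ennreal (2 ^ DIM('a)) * ?I) \<partial>lborel)"
    proof (rule nn_integral_mono)
      fix x :: 'a
      have "(\<integral>\<^sup>+z. ennreal (b z * (b x * \<bar>x \<bullet> e\<bar> powr p)) * H (x + t *\<^sub>R (z - x)) \<partial>lborel)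
        \<le> (\<integral>\<^sup>+z. ennreal (W x) * H ((1 - t) *\<^sub>R x + t *\<^sub>R z) \<partial>lborel)"
        using b0 W0 unfolding W_def[symmetric]
        by (intro nn_integral_mono mult_mono ennreal_leI) (auto simp: algebra_simps mult_left_le)
      also have "\<dots> = ennreal (W x) * (\<integral>\<^sup>+z. H ((1 - t) *\<^sub>R x + t *\<^sub>R z) \<partial>lborel)"
        by (rule nn_integral_cmult) simp
      also have "\<dots> \<le> ennreal (W x) * (ennreal (2 ^ DIM('a)) * ?I)"
        using False assms by (intro mult_left_mono nn_integral_affine_le) auto
      finally show "(\<integral>\<^sup>+z. ennreal (b z * (b x * \<bar>x \<bullet> e\<bar> powr p)) * H (x + t *\<^sub>R (z - x)) \<partial>lborel) \<le> \<dots>" .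
    qed
    also have "\<dots> = (\<integral>\<^sup>+x. ennreal (W x) \<partial>lborel) * (ennreal (2 ^ DIM('a)) * ?I)"
      by (rule nn_integral_multc) simp
    also have "\<dots> \<le> ennreal ?M * (ennreal (2 ^ DIM('a)) * ?I)"
    proof (rule mult_right_mono)
      have "(\<integral>\<^sup>+x. ennreal (W x) \<partial>lborel) \<le> (\<integral>\<^sup>+x. ennreal (indicator (cube r) x * \<bar>x \<bullet> e\<bar> powr p) \<partial>lborel)"
        using ball_subset_cube[of r, where 'a='a]
        by (intro nn_integral_mono ennreal_leI) (auto simp: W_def b_def indicator_def)
      also note J
      also have "ennreal (J * r powr (real DIM('a) + p)) \<le> ennreal ?M"
        using assms by (intro ennreal_leI) (simp add: algebra_simps add_nonneg_nonneg)
      finally show "(\<integral>\<^sup>+x. ennreal (W x) \<partial>lborel) \<le> ennreal ?M" .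
    qed simp
    finally show ?thesis by (simp add: mult_ac)
  qed
  also have "ennreal (2 ^ DIM('a)) * ennreal ?M = ennreal (2 ^ DIM('a) * ?M)"
    using Mpos by (intro ennreal_mult[symmetric]) auto
  finally show ?thesis .
qed

lemma segment_weight_bound:
  fixes e :: "'a::euclidean_space"
  assumes "p > -1" "e \<in> Basis"
  shows "\<exists>K>0. \<forall>r>0. \<forall>H \<in> borel_measurable borel.
    (\<integral>\<^sup>+x. \<integral>\<^sup>+z. ennreal (indicator (ball 0 r) z * (indicator (ball 0 r) x * \<bar>x \<bullet> e\<bar> powr p)) *
        (\<integral>\<^sup>+t. indicator {0..1} t * H (x + t *\<^sub>R (z - x)) \<partial>lborel) \<partial>lborel \<partial>lborel)
    \<le> ennreal (K * r powr (real DIM('a) + p)) * (\<integral>\<^sup>+x. H x \<partial>lborel)"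
proof -
  obtain J where J: "J > 0" "\<And>r. r > 0 \<Longrightarrow>
    (\<integral>\<^sup>+x. ennreal (indicator (cube r) x * \<bar>x \<bullet> e\<bar> powr p) \<partial>lborel) \<le> ennreal (J * r powr (real DIM('a) + p))"
    using nn_integral_powr_cube[OF assms] by blast
  \<comment> \<open>The last factor is the integral of 1 + t^p over the unit interval, finite
    because p > -1.\<close>
  define K where "K = 2 ^ DIM('a) * (J + 2 ^ DIM('a)) * (1 + 1 / (p + 1))"
  have "K > 0" using J(1) assms(1) by (auto simp: K_def intro!: mult_pos_pos add_pos_pos)
  have tint: "(\<integral>\<^sup>+t. indicator {0..1} t * ennreal (1 + t powr p) \<partial>lborel) = ennreal (1 + 1 / (p + 1))"
  proof -
    have "((\<lambda>t. 1 + t powr p) has_integral (1 + 1 / (p + 1))) {0..1}"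
      using has_integral_add[OF has_integral_const_real[of 1 0 1] has_integral_powr_from_0[of p 1]] assms(1) by simp
    then have "(\<integral>\<^sup>+t. ennreal (indicator {0..1} t * (1 + t powr p)) \<partial>lborel) = ennreal (1 + 1 / (p + 1))"
      by (intro nn_integral_has_integral_lebesgue) auto
    then show ?thesis by (simp add: ennreal_mult ennreal_indicator del: ennreal_plus)
  qed
  have "(\<integral>\<^sup>+x. \<integral>\<^sup>+z. ennreal (indicator (ball 0 r) z * (indicator (ball 0 r) x * \<bar>x \<bullet> e\<bar> powr p)) *
        (\<integral>\<^sup>+t. indicator {0..1} t * H (x + t *\<^sub>R (z - x)) \<partial>lborel) \<partial>lborel \<partial>lborel)
    \<le> ennreal (K * r powr (real DIM('a) + p)) * (\<integral>\<^sup>+x. H x \<partial>lborel)" (is "?L \<le> _")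
    if r: "r > 0" and [measurable]: "H \<in> borel_measurable borel" for r and H :: "'a \<Rightarrow> ennreal"
  proof -
    define w where "w x z = ennreal (indicator (ball 0 r) z * (indicator (ball 0 r) x * \<bar>x \<bullet> e\<bar> powr p))" for x z :: 'a
    define I where "I = (\<integral>\<^sup>+x. H x \<partial>lborel)"
    define A where "A = 2 ^ DIM('a) * ((J + 2 ^ DIM('a)) * r powr (real DIM('a) + p))"
    have "A \<ge> 0" using J(1) by (simp add: A_def)
    have [measurable]: "(\<lambda>x. w (f x) (g x)) \<in> borel_measurable M"
      if "f \<in> borel_measurable M" "g \<in> borel_measurable M" for f g and M :: "'z measure"
      using that unfolding w_def by measurable
    have "?L = (\<integral>\<^sup>+x. \<integral>\<^sup>+z. \<integral>\<^sup>+t. indicator {0..1} t * (w x z * H (x + t *\<^sub>R (z - x))) \<partial>lborel \<partial>lborel \<partial>lborel)"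
      unfolding w_def[symmetric] by (simp add: nn_integral_cmult[symmetric] mult_ac)
    also have "\<dots> = (\<integral>\<^sup>+x. \<integral>\<^sup>+t. \<integral>\<^sup>+z. indicator {0..1} t * (w x z * H (x + t *\<^sub>R (z - x))) \<partial>lborel \<partial>lborel \<partial>lborel)"
      by (intro nn_integral_cong lborel_pair.Fubini') measurable
    also have "\<dots> = (\<integral>\<^sup>+t. \<integral>\<^sup>+x. \<integral>\<^sup>+z. indicator {0..1} t * (w x z * H (x + t *\<^sub>R (z - x))) \<partial>lborel \<partial>lborel \<partial>lborel)"
      by (intro lborel_pair.Fubini') measurable
    also have "\<dots> \<le> (\<integral>\<^sup>+t. indicator {0..1} t * ennreal (1 + t powr p) * (ennreal A * I) \<partial>lborel)"
    proof (rule nn_integral_mono_AE, rule AE_mp[OF AE_conjI[OF AE_lborel_singleton[of 0] AE_lborel_singleton[of 1]]], rule AE_I2, rule impI)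
      \<comment> \<open>The bound at fixed t holds for interior t only; the two endpoints form a
        null set.\<close>
      fix t :: real assume t: "t \<noteq> 0 \<and> t \<noteq> 1"
      have "(\<integral>\<^sup>+x. \<integral>\<^sup>+z. indicator {0..1} t * (w x z * H (x + t *\<^sub>R (z - x))) \<partial>lborel \<partial>lborel)
          = indicator {0..1} t * (\<integral>\<^sup>+x. \<integral>\<^sup>+z. w x z * H (x + t *\<^sub>R (z - x)) \<partial>lborel \<partial>lborel)"
        by (simp add: nn_integral_cmult)
      also have "\<dots> \<le> indicator {0..1} t * (ennreal (A * (1 + t powr p)) * I)"
      proof (cases "0 < t \<and> t < 1")
        case True
        then show ?thesis
          using segment_weight_bound_at[OF assms(2) r _ _ J(1) J(2)[OF r], of t H]
          unfolding w_def I_def A_def by (intro mult_left_mono) (auto simp: mult_ac)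
      qed (use t in \<open>auto simp: indicator_def\<close>)
      also have "\<dots> = indicator {0..1} t * ennreal (1 + t powr p) * (ennreal A * I)"
        using \<open>A \<ge> 0\<close> by (simp add: ennreal_mult mult_ac del: ennreal_plus)
      finally show "(\<integral>\<^sup>+x. \<integral>\<^sup>+z. indicator {0..1} t * (w x z * H (x + t *\<^sub>R (z - x))) \<partial>lborel \<partial>lborel)
        \<le> indicator {0..1} t * ennreal (1 + t powr p) * (ennreal A * I)" .
    qed
    also have "\<dots> = ennreal (1 + 1 / (p + 1)) * (ennreal A * I)"
      by (subst nn_integral_multc) (simp_all add: tint del: ennreal_plus)
    also have "\<dots> = ennreal (K * r powr (real DIM('a) + p)) * I"
    proof -
      have "ennreal (1 + 1 / (p + 1)) * ennreal A = ennreal ((1 + 1 / (p + 1)) * A)"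
        using assms(1) \<open>A \<ge> 0\<close> by (intro ennreal_mult[symmetric]) auto
      also have "(1 + 1 / (p + 1)) * A = K * r powr (real DIM('a) + p)"
        by (simp add: A_def K_def mult_ac)
      finally show ?thesis by (simp add: mult.assoc[symmetric])
    qed
    finally show ?thesis unfolding I_def .
  qed
  with \<open>K > 0\<close> show ?thesis by blast
qed

section \<open>Truncation and approximation\<close>

text \<open>Squaring removes the corner of the positive part. Such truncated squares are the
  building blocks of a quadratic spline with knots 0, 1/2 and 1.\<close>

lemma has_real_derivative_max_0_sq [derivative_intros]:
  "((\<lambda>s. (max 0 s)\<^sup>2) has_real_derivative 2 * max 0 s) (at s)"
proof -
  consider "s > 0" | "s < 0" | "s = 0" by linarith
  then show ?thesis
  proof cases
    case 1
    have "((\<lambda>s. s\<^sup>2) has_real_derivative 2 * max 0 s) (at s)"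
      using 1 by (auto intro!: derivative_eq_intros)
    then show ?thesis
      by (rule has_field_derivative_transform_within[OF _ 1]) (auto simp: dist_real_def max_def)
  next
    case 2
    have "((\<lambda>s. 0) has_real_derivative 2 * max 0 s) (at s)" using 2 by simp
    then show ?thesis
      by (rule has_field_derivative_transform_within[of _ _ _ _ "-s"]) (use 2 in \<open>auto simp: dist_real_def max_def\<close>)
  next
    case 3
    have "((\<lambda>h. (max 0 h)\<^sup>2 / h) \<longlongrightarrow> 0) (at (0::real))"
    proof (rule Lim_null_comparison)
      show "\<forall>\<^sub>F h in at 0. norm ((max 0 h)\<^sup>2 / h) \<le> \<bar>h\<bar>"
        by (rule always_eventually) (auto simp: max_def power2_eq_square)
      show "((\<lambda>h::real. \<bar>h\<bar>) \<longlongrightarrow> 0) (at 0)"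
        by (auto intro!: tendsto_eq_intros)
    qed
    with 3 show ?thesis by (simp add: DERIV_def)
  qed
qed

text \<open>A \<open>C\<^sup>1\<close> transition from 0 to 1 whose derivative vanishes outside the open unit interval:
  composed with \<open>u\<close>, its gradient lives on \<open>{k < u < \<ell>}\<close> only.\<close>

definition step :: "real \<Rightarrow> real" where
  "step s = 2 * (max 0 s)\<^sup>2 - 4 * (max 0 (s - 1/2))\<^sup>2 + 2 * (max 0 (s - 1))\<^sup>2"

text \<open>A tent over the unit interval with peak 2 at 1/2, hence of area 1. The peak is the
  factor 2 in the gradient bound.\<close>

definition step' :: "real \<Rightarrow> real" where
  "step' s = 4 * max 0 s - 8 * max 0 (s - 1/2) + 4 * max 0 (s - 1)"

lemma has_real_derivative_step: "(step has_real_derivative step' s) (at s)"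
proof -
  have d: "((\<lambda>s. (max 0 (s - c))\<^sup>2) has_real_derivative 2 * max 0 (s - c)) (at s)" for c
  proof -
    have "((\<lambda>s. s - c) has_real_derivative 1) (at s)"
      by (auto intro!: derivative_eq_intros)
    from DERIV_chain2[where f="\<lambda>s. (max 0 s)\<^sup>2" and g="\<lambda>s. s - c",
        OF has_real_derivative_max_0_sq[of "s - c"] this]
    show ?thesis by simp
  qed
  show ?thesis
    using DERIV_add[OF DERIV_diff[OF DERIV_cmult[OF d[of 0], of 2] DERIV_cmult[OF d[of "1/2"], of 4]]
        DERIV_cmult[OF d[of 1], of 2]]
    by (simp add: step_def[abs_def] step'_def)
qed

lemma step_eq_0: "s \<le> 0 \<Longrightarrow> step s = 0"
  by (simp add: step_def max_def)

lemma step_eq_1: "s \<ge> 1 \<Longrightarrow> step s = 1"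
  by (auto simp: step_def max_def power2_eq_square algebra_simps)

lemma step'_bounds: "0 \<le> step' s" "step' s \<le> 2"
  by (auto simp: step'_def max_def)

lemma step'_eq_0: "s \<le> 0 \<or> s \<ge> 1 \<Longrightarrow> step' s = 0"
  by (auto simp: step'_def max_def)

lemma continuous_on_step [continuous_intros]: "continuous_on S f \<Longrightarrow> continuous_on S (\<lambda>x. step (f x))"
  unfolding step_def by (intro continuous_intros)

lemma continuous_on_step' [continuous_intros]: "continuous_on S f \<Longrightarrow> continuous_on S (\<lambda>x. step' (f x))"
  unfolding step'_def by (intro continuous_intros)

lemma borel_measurable_step [measurable]: "step \<in> borel_measurable borel" "step' \<in> borel_measurable borel"
  by (auto intro!: borel_measurable_continuous_onI continuous_intros)

lemma tendsto_step: "(f \<longlongrightarrow> a) F \<Longrightarrow> ((\<lambda>x. step (f x)) \<longlongrightarrow> step a) F"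
  using continuous_on_tendsto_compose[of UNIV step f a F] continuous_on_step[of UNIV "\<lambda>x. x"] by simp

lemma tendsto_step': "(f \<longlongrightarrow> a) F \<Longrightarrow> ((\<lambda>x. step' (f x)) \<longlongrightarrow> step' a) F"
  using continuous_on_tendsto_compose[of UNIV step' f a F] continuous_on_step'[of UNIV "\<lambda>x. x"] by simp

text \<open>One sequence must serve both functions. The radii make both L^1 errors at most 1/(m+1);
  a subsequence then gives convergence almost everywhere for U, and the L^1 convergence for G
  survives the passage to it.\<close>

lemma mollify_sequence:
  fixes U :: "'a::euclidean_space \<Rightarrow> 'b::euclidean_space" and G :: "'a \<Rightarrow> 'c::euclidean_space"
  assumes U: "integrable lborel U" and G: "integrable lborel G"
  shows "\<exists>d. (\<forall>m::nat. d m > 0) \<and> d \<longlonglongrightarrow> 0 \<and> (AE x in lborel. (\<lambda>m. mollify (d m) U x) \<longlonglongrightarrow> U x) \<and>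
    (\<lambda>m. \<integral>\<^sup>+x. norm (mollify (d m) G x - G x) \<partial>lborel) \<longlonglongrightarrow> 0"
proof -
  define e where "e m = inverse (real (Suc m))" for m
  have e: "e m > 0" for m by (simp add: e_def)
  have elim: "e \<longlonglongrightarrow> 0" unfolding e_def by (rule LIMSEQ_inverse_real_of_nat)
  have "\<exists>d. 0 < d \<and> d < e m \<and> (\<integral>\<^sup>+x. norm (mollify d U x - U x) \<partial>lborel) \<le> ennreal (e m) \<and>
      (\<integral>\<^sup>+x. norm (mollify d G x - G x) \<partial>lborel) \<le> ennreal (e m)" for m
  proof -
    obtain D1 where D1: "D1 > 0" "\<And>d. 0 < d \<Longrightarrow> d < D1 \<Longrightarrow> (\<integral>\<^sup>+x. norm (mollify d U x - U x) \<partial>lborel) \<le> ennreal (e m)"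
      using mollify_L1[OF U e] by blast
    obtain D2 where D2: "D2 > 0" "\<And>d. 0 < d \<Longrightarrow> d < D2 \<Longrightarrow> (\<integral>\<^sup>+x. norm (mollify d G x - G x) \<partial>lborel) \<le> ennreal (e m)"
      using mollify_L1[OF G e] by blast
    have "0 < min (e m) (min D1 D2)" using D1(1) D2(1) e[of m] by simp
    then obtain d where "0 < d" "d < min (e m) (min D1 D2)"
      using dense by blast
    then show ?thesis using D1(2) D2(2) by auto
  qed
  from choice[OF allI[OF this]] obtain d where
    "\<forall>m. 0 < d m \<and> d m < e m \<and> (\<integral>\<^sup>+x. norm (mollify (d m) U x - U x) \<partial>lborel) \<le> ennreal (e m) \<and>
      (\<integral>\<^sup>+x. norm (mollify (d m) G x - G x) \<partial>lborel) \<le> ennreal (e m)" ..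
  then have d: "\<And>m. 0 < d m" "\<And>m. d m < e m"
    "\<And>m. (\<integral>\<^sup>+x. norm (mollify (d m) U x - U x) \<partial>lborel) \<le> ennreal (e m)"
    "\<And>m. (\<integral>\<^sup>+x. norm (mollify (d m) G x - G x) \<partial>lborel) \<le> ennreal (e m)"
    by blast+
  have [measurable]: "U \<in> borel_measurable borel" using U by auto
  have [measurable]: "mollify (d m) U \<in> borel_measurable borel" for m
    by (rule borel_measurable_continuous_onI[OF continuous_on_mollify[OF d(1) U]])
  have int: "integrable lborel (\<lambda>x. mollify (d m) U x - U x)" for m
    using order_le_less_trans[OF d(3)[of m] ennreal_less_top] by (intro integrableI_bounded) auto
  have le: "(\<integral>x. norm (mollify (d m) U x - U x) \<partial>lborel) \<le> e m" for m
  proof -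
    have "ennreal (\<integral>x. norm (mollify (d m) U x - U x) \<partial>lborel) = (\<integral>\<^sup>+x. norm (mollify (d m) U x - U x) \<partial>lborel)"
      using int by (intro nn_integral_eq_integral[symmetric]) auto
    also note d(3)
    finally show ?thesis using e[of m] by (simp add: ennreal_le_iff less_imp_le)
  qed
  have "(\<lambda>m. \<integral>x. norm (mollify (d m) U x - U x) \<partial>lborel) \<longlonglongrightarrow> 0"
    by (rule tendsto_sandwich[OF _ _ tendsto_const elim]) (auto simp: le)
  from tendsto_L1_AE_subseq[OF int this] obtain s :: "nat \<Rightarrow> nat" where
    s: "strict_mono s" "AE x in lborel. (\<lambda>m. mollify (d (s m)) U x - U x) \<longlonglongrightarrow> 0"
    by blast
  have "d \<longlonglongrightarrow> 0"
    by (rule tendsto_sandwich[OF _ _ tendsto_const elim]) (use d in \<open>auto intro!: always_eventually less_imp_le\<close>)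
  then have 1: "(\<lambda>m. d (s m)) \<longlonglongrightarrow> 0"
    using LIMSEQ_subseq_LIMSEQ[OF _ s(1)] by (auto simp: comp_def)
  have "(\<lambda>m. ennreal (e m)) \<longlonglongrightarrow> 0"
    using tendsto_ennrealI[OF elim] by simp
  then have "(\<lambda>m. \<integral>\<^sup>+x. norm (mollify (d m) G x - G x) \<partial>lborel) \<longlonglongrightarrow> 0"
    by (rule tendsto_sandwich[OF _ _ tendsto_const, rotated 2]) (use d in auto)
  then have 2: "(\<lambda>m. \<integral>\<^sup>+x. norm (mollify (d (s m)) G x - G x) \<partial>lborel) \<longlonglongrightarrow> 0"
    using LIMSEQ_subseq_LIMSEQ[OF _ s(1)] by (auto simp: comp_def)
  have 3: "AE x in lborel. (\<lambda>m. mollify (d (s m)) U x) \<longlonglongrightarrow> U x"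
    using s(2) by eventually_elim (rule LIM_zero_cancel)
  show ?thesis
    by (rule exI[of _ "\<lambda>m. d (s m)"]) (use d(1) 1 2 3 in auto)
qed

text \<open>To be used for Borel representatives that are extended by zero to the whole space.\<close>

definition weak_gradient :: "'a::euclidean_space set \<Rightarrow> ('a \<Rightarrow> real) \<Rightarrow> ('a \<Rightarrow> 'a) \<Rightarrow> bool" where
  "weak_gradient S U G \<longleftrightarrow> (\<forall>\<phi>\<in>test_functions S. \<forall>b\<in>Basis.
     (\<integral>y. U y * frechet_derivative \<phi> (at y) b \<partial>lborel) = - (\<integral>y. (G y \<bullet> b) * \<phi> y \<partial>lborel))"

text \<open>Fundamental theorem of calculus along the segment; the factor 2 r bounds the length of z
  - x.\<close>

lemma step_mollify_difference:
  fixes U :: "'a::euclidean_space \<Rightarrow> real" and G :: "'a \<Rightarrow> 'a"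
  assumes U: "integrable lborel U" and G: "integrable lborel G" and "d > 0" "k < l"
    and weak: "weak_gradient (ball 0 r) U G"
    and x: "norm x < r - d" and z: "norm z < r - d"
  shows "ennreal \<bar>step ((mollify d U x - k) / (l - k)) - step ((mollify d U z - k) / (l - k))\<bar>
    \<le> ennreal (2 * r) * (\<integral>\<^sup>+t. indicator {0..1} t *
        ennreal (step' ((mollify d U (x + t *\<^sub>R (z - x)) - k) / (l - k)) / (l - k) * norm (mollify d G (x + t *\<^sub>R (z - x)))) \<partial>lborel)"
proof -
  define V where "V t = step ((mollify d U (x + t *\<^sub>R (z - x)) - k) / (l - k))" for t
  define S' where "S' t = step' ((mollify d U (x + t *\<^sub>R (z - x)) - k) / (l - k)) / (l - k)" for t
  define g where "g t = mollify d G (x + t *\<^sub>R (z - x))" for t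
  have cU: "continuous_on T (\<lambda>t. mollify d U (x + t *\<^sub>R (z - x)))" for T
    by (rule continuous_on_compose2[OF continuous_on_mollify[OF \<open>d > 0\<close> U, of UNIV]]) (auto intro!: continuous_intros)
  have cg: "continuous_on T g" for T
    unfolding g_def
    by (rule continuous_on_compose2[OF continuous_on_mollify[OF \<open>d > 0\<close> G, of UNIV]]) (auto intro!: continuous_intros)
  have cS': "continuous_on T S'" for T
    unfolding S'_def using \<open>k < l\<close> by (intro continuous_intros cU) auto
  have S'0: "S' t \<ge> 0" for t using \<open>k < l\<close> step'_bounds by (simp add: S'_def)
  have deriv: "(V has_real_derivative S' t * (g t \<bullet> (z - x))) (at t)" if t: "0 \<le> t" "t \<le> 1" for t
  proof -
    \<comment> \<open>By convexity the whole segment stays in the ball of radius r - d, so the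
      kernels centred on it are test functions of the large ball.\<close>
    have "(1 - t) *\<^sub>R x + t *\<^sub>R z \<in> ball 0 (r - d)"
      by (rule convexD_alt[OF convex_ball]) (use x z t in auto)
    moreover have "(1 - t) *\<^sub>R x + t *\<^sub>R z = x + t *\<^sub>R (z - x)"
      by (simp add: algebra_simps)
    ultimately have xt: "norm (x + t *\<^sub>R (z - x)) < r - d" by simp
    have sub: "cball (x + t *\<^sub>R (z - x)) d \<subseteq> ball 0 r"
    proof
      fix y assume "y \<in> cball (x + t *\<^sub>R (z - x)) d"
      then have "norm (y - (x + t *\<^sub>R (z - x))) \<le> d" by (simp add: dist_norm norm_minus_commute)
      with xt norm_triangle_sub[of y "x + t *\<^sub>R (z - x)"] show "y \<in> ball 0 r"
        by (simp only: mem_ball_0)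
    qed
    have "((\<lambda>t. mollify d U (x + t *\<^sub>R (z - x))) has_real_derivative g t \<bullet> (z - x)) (at t)"
      unfolding g_def using weak sub
      by (intro mollify_line_derivative[OF U G \<open>d > 0\<close>]) (auto simp: weak_gradient_def)
    then have "((\<lambda>t. (mollify d U (x + t *\<^sub>R (z - x)) - k) / (l - k)) has_real_derivative (g t \<bullet> (z - x)) / (l - k)) (at t)"
      using \<open>k < l\<close> by (auto intro!: derivative_eq_intros)
    from DERIV_chain2[OF has_real_derivative_step this] show ?thesis
      by (simp add: V_def[abs_def] S'_def)
  qed
  define F where "F t = S' t * (g t \<bullet> (z - x))" for t
  have cF: "continuous_on {0..1} F"
    unfolding F_def by (intro continuous_intros cS' cg)
  have "integral\<^sup>L lborel (\<lambda>t. indicator {0..1} t *\<^sub>R F t) = V 1 - V 0"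
    using deriv cF unfolding F_def
    by (intro integral_FTC_atLeastAtMost)
      (auto simp flip: has_real_derivative_iff_has_vector_derivative intro: has_field_derivative_at_within)
  moreover have "integrable lborel (\<lambda>t. indicator {0..1} t *\<^sub>R F t)"
    using borel_integrable_atLeastAtMost'[OF cF] by (simp add: set_integrable_def)
  ultimately have "ennreal \<bar>V 1 - V 0\<bar> \<le> (\<integral>\<^sup>+t. ennreal (norm (indicator {0..1} t *\<^sub>R F t)) \<partial>lborel)"
    using integral_norm_bound_ennreal by (metis real_norm_def)
  also have "\<dots> \<le> (\<integral>\<^sup>+t. ennreal (2 * r) * (indicator {0..1} t * ennreal (S' t * norm (g t))) \<partial>lborel)"
  proof (rule nn_integral_mono)
    fix t :: real
    have r: "norm (z - x) \<le> 2 * r" using x z \<open>d > 0\<close> norm_triangle_ineq4[of z x] by linarith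
    then have "r \<ge> 0" using norm_ge_zero[of "z - x"] by linarith
    have "\<bar>F t\<bar> \<le> S' t * (norm (g t) * norm (z - x))"
      using S'0[of t] Cauchy_Schwarz_ineq2[of "g t" "z - x"] by (auto simp: F_def abs_mult intro!: mult_left_mono)
    also have "\<dots> \<le> S' t * (norm (g t) * (2 * r))"
      by (intro mult_left_mono r S'0 norm_ge_zero)
    finally have "\<bar>F t\<bar> \<le> 2 * r * (S' t * norm (g t))" by (simp add: mult_ac)
    then show "ennreal (norm (indicator {0..1} t *\<^sub>R F t)) \<le> ennreal (2 * r) * (indicator {0..1} t * ennreal (S' t * norm (g t)))"
      using \<open>r \<ge> 0\<close> S'0[of t] by (auto simp: indicator_def ennreal_mult[symmetric] intro!: ennreal_leI)
  qed
  also have "\<dots> = ennreal (2 * r) * (\<integral>\<^sup>+t. indicator {0..1} t * ennreal (S' t * norm (g t)) \<partial>lborel)"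
  proof (rule nn_integral_cmult)
    have [measurable]: "S' \<in> borel_measurable borel" "g \<in> borel_measurable borel"
      by (auto intro!: borel_measurable_continuous_onI cS' cg)
    show "(\<lambda>t. indicator {0..1} t * ennreal (S' t * norm (g t))) \<in> borel_measurable lborel" by measurable
  qed
  finally show ?thesis
    unfolding V_def S'_def g_def by (simp add: abs_minus_commute)
qed

text \<open>The mollified values converge almost everywhere and the mollified gradients in L^1. The
  double integral on the left therefore passes to the limit by Fatou, while the gradient integral on
  the right is compared with one that converges.\<close>

lemma truncated_poincare:
  fixes e :: "'a::euclidean_space"
  assumes "p > -1" "e \<in> Basis"
  shows "\<exists>K>0. \<forall>(k::real) (l::real) (r::real) (U :: 'a \<Rightarrow> real) (G :: 'a \<Rightarrow> 'a).
    k < l \<longrightarrow> r > 0 \<longrightarrow> integrable lborel U \<longrightarrow> integrable lborel G \<longrightarrow> weak_gradient (ball 0 r) U G \<longrightarrow>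
    (\<integral>\<^sup>+x. \<integral>\<^sup>+z. ennreal (indicator (ball 0 r) z * (indicator (ball 0 r) x * \<bar>x \<bullet> e\<bar> powr p)) *
        ennreal \<bar>step ((U x - k) / (l - k)) - step ((U z - k) / (l - k))\<bar> \<partial>lborel \<partial>lborel)
    \<le> ennreal (K * r powr (real DIM('a) + p + 1)) * (\<integral>\<^sup>+x. ennreal (step' ((U x - k) / (l - k)) / (l - k) * norm (G x)) \<partial>lborel)"
proof -
  obtain K where K: "K > 0" "\<And>r H. r > 0 \<Longrightarrow> H \<in> borel_measurable borel \<Longrightarrow>
    (\<integral>\<^sup>+x. \<integral>\<^sup>+z. ennreal (indicator (ball 0 r) z * (indicator (ball 0 r) x * \<bar>x \<bullet> e\<bar> powr p)) *
        (\<integral>\<^sup>+t. indicator {0..1} t * H (x + t *\<^sub>R (z - x)) \<partial>lborel) \<partial>lborel \<partial>lborel)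
    \<le> ennreal (K * r powr (real DIM('a) + p)) * (\<integral>\<^sup>+x. H x \<partial>lborel)"
    using segment_weight_bound[OF assms] by blast
  have "(\<integral>\<^sup>+x. \<integral>\<^sup>+z. ennreal (indicator (ball 0 r) z * (indicator (ball 0 r) x * \<bar>x \<bullet> e\<bar> powr p)) *
        ennreal \<bar>step ((U x - k) / (l - k)) - step ((U z - k) / (l - k))\<bar> \<partial>lborel \<partial>lborel)
    \<le> ennreal (2 * K * r powr (real DIM('a) + p + 1)) * (\<integral>\<^sup>+x. ennreal (step' ((U x - k) / (l - k)) / (l - k) * norm (G x)) \<partial>lborel)"
    if kl: "k < l" and r: "r > 0" and U: "integrable lborel U" and G: "integrable lborel G"
      and weak: "weak_gradient (ball 0 r) U G" for k l r :: real and U :: "'a \<Rightarrow> real" and G :: "'a \<Rightarrow> 'a"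
  proof -
    obtain d where d: "\<And>m::nat. d m > 0" "d \<longlonglongrightarrow> 0" "AE x in lborel. (\<lambda>m. mollify (d m) U x) \<longlonglongrightarrow> U x"
      "(\<lambda>m. \<integral>\<^sup>+x. norm (mollify (d m) G x - G x) \<partial>lborel) \<longlonglongrightarrow> 0"
      using mollify_sequence[OF U G] by blast
    define w where "w x z = ennreal (indicator (ball 0 r) z * (indicator (ball 0 r) x * \<bar>x \<bullet> e\<bar> powr p))" for x z :: 'a
    define \<sigma> where "\<sigma> s = step ((s - k) / (l - k))" for s
    define \<sigma>' where "\<sigma>' s = step' ((s - k) / (l - k)) / (l - k)" for s
    define u where "u m = mollify (d m) U" for m
    define g where "g m = mollify (d m) G" for m
    have [measurable]: "U \<in> borel_measurable borel" "G \<in> borel_measurable borel" using U G by auto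
    have [measurable]: "u m \<in> borel_measurable borel" "g m \<in> borel_measurable borel" for m
      unfolding u_def g_def by (auto intro!: borel_measurable_continuous_onI continuous_on_mollify U G d(1))
    have [measurable]: "\<sigma> \<in> borel_measurable borel" "\<sigma>' \<in> borel_measurable borel"
      unfolding \<sigma>_def[abs_def] \<sigma>'_def[abs_def] by measurable
    have [measurable]: "(\<lambda>x. w (f x) (h x)) \<in> borel_measurable M"
      if "f \<in> borel_measurable M" "h \<in> borel_measurable M" for f h and M :: "'z measure"
      using that unfolding w_def by measurable
    have \<sigma>'0: "0 \<le> \<sigma>' s" and \<sigma>'2: "\<sigma>' s \<le> 2 / (l - k)" for s
      using kl step'_bounds by (auto simp: \<sigma>'_def divide_right_mono)
    have lim\<sigma>: "(\<lambda>m. \<sigma> (u m x)) \<longlonglongrightarrow> \<sigma> (U x)" and lim\<sigma>': "(\<lambda>m. \<sigma>' (u m x)) \<longlonglongrightarrow> \<sigma>' (U x)"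
      if "(\<lambda>m. mollify (d m) U x) \<longlonglongrightarrow> U x" for x
      unfolding \<sigma>_def \<sigma>'_def u_def using that kl
      by (auto intro!: tendsto_step tendsto_step' tendsto_intros)
    \<comment> \<open>Cutoff to the points at which the mollified difference is controlled; it is
      eventually 1 at every point of the open ball.\<close>
    define B where "B m x = (if norm x < r - d m then 1 else 0 :: ennreal)" for m and x :: 'a
    have [measurable]: "B m \<in> borel_measurable borel" for m unfolding B_def[abs_def] by measurable
    \<comment> \<open>The length bound 2 r of the segments times the constant K r^(n+p) of the
      weight estimate.\<close>
    define C where "C = ennreal (2 * K * r powr (real DIM('a) + p + 1))"
    \<comment> \<open>Replacing the mollified gradient by G costs at most the maximum 2 / (l - k) of
      the truncation's derivative times the L^1 error, which vanishes. In the other summand only the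
      bounded factor depends on m, so dominated convergence applies.\<close>
    define R where "R m = ennreal (2 / (l - k)) * (\<integral>\<^sup>+x. norm (g m x - G x) \<partial>lborel) + (\<integral>\<^sup>+x. ennreal (\<sigma>' (u m x) * norm (G x)) \<partial>lborel)" for m
    define L where "L m x = (\<integral>\<^sup>+z. w x z * (B m x * B m z * ennreal \<bar>\<sigma> (u m x) - \<sigma> (u m z)\<bar>) \<partial>lborel)" for m x
    have [measurable]: "L m \<in> borel_measurable borel" for m unfolding L_def[abs_def] by measurable

    have bound: "(\<integral>\<^sup>+x. L m x \<partial>lborel) \<le> C * R m" for m
    proof -
      define H where "H x = ennreal (\<sigma>' (u m x) * norm (g m x))" for x
      have [measurable]: "H \<in> borel_measurable borel" unfolding H_def[abs_def] by measurable
      have "(\<integral>\<^sup>+x. L m x \<partial>lborel) \<le> (\<integral>\<^sup>+x. \<integral>\<^sup>+z. ennreal (2 * r) * (w x z * (\<integral>\<^sup>+t. indicator {0..1} t * H (x + t *\<^sub>R (z - x)) \<partial>lborel)) \<partial>lborel \<partial>lborel)"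
        unfolding L_def
      proof (intro nn_integral_mono)
        fix x z :: 'a
        have "B m x * B m z * ennreal \<bar>\<sigma> (u m x) - \<sigma> (u m z)\<bar> \<le> ennreal (2 * r) * (\<integral>\<^sup>+t. indicator {0..1} t * H (x + t *\<^sub>R (z - x)) \<partial>lborel)"
        proof (cases "norm x < r - d m \<and> norm z < r - d m")
          case True
          then show ?thesis
            using step_mollify_difference[OF U G d(1)[of m] kl weak] by (simp add: B_def H_def \<sigma>_def \<sigma>'_def u_def g_def)
        qed (auto simp: B_def)
        from mult_left_mono[OF this, of "w x z"]
        show "w x z * (B m x * B m z * ennreal \<bar>\<sigma> (u m x) - \<sigma> (u m z)\<bar>) \<le> ennreal (2 * r) * (w x z * (\<integral>\<^sup>+t. indicator {0..1} t * H (x + t *\<^sub>R (z - x)) \<partial>lborel))"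
          by (simp add: mult_ac)
      qed
      also have "\<dots> = ennreal (2 * r) * (\<integral>\<^sup>+x. \<integral>\<^sup>+z. w x z * (\<integral>\<^sup>+t. indicator {0..1} t * H (x + t *\<^sub>R (z - x)) \<partial>lborel) \<partial>lborel \<partial>lborel)"
        by (simp add: nn_integral_cmult)
      also have "\<dots> \<le> ennreal (2 * r) * (ennreal (K * r powr (real DIM('a) + p)) * (\<integral>\<^sup>+x. H x \<partial>lborel))"
        unfolding w_def by (intro mult_left_mono K(2) r) auto
      also have "\<dots> = C * (\<integral>\<^sup>+x. H x \<partial>lborel)"
      proof -
        have "ennreal (2 * r) * ennreal (K * r powr (real DIM('a) + p)) = C"
          using r K(1) by (simp add: C_def powr_add ennreal_mult[symmetric] mult_ac)
        then show ?thesis by (simp add: mult.assoc[symmetric])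
      qed
      also have "(\<integral>\<^sup>+x. H x \<partial>lborel) \<le> (\<integral>\<^sup>+x. ennreal (2 / (l - k)) * ennreal (norm (g m x - G x)) + ennreal (\<sigma>' (u m x) * norm (G x)) \<partial>lborel)"
      proof (rule nn_integral_mono)
        fix x
        have "\<sigma>' (u m x) * norm (g m x) \<le> \<sigma>' (u m x) * (norm (g m x - G x) + norm (G x))"
          using norm_triangle_ineq[of "g m x - G x" "G x"] by (intro mult_left_mono \<sigma>'0) simp
        also have "\<dots> \<le> 2 / (l - k) * norm (g m x - G x) + \<sigma>' (u m x) * norm (G x)"
          unfolding distrib_left by (intro add_mono mult_right_mono \<sigma>'2) auto
        finally show "H x \<le> ennreal (2 / (l - k)) * ennreal (norm (g m x - G x)) + ennreal (\<sigma>' (u m x) * norm (G x))"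
          using kl \<sigma>'0 by (simp add: H_def ennreal_mult[symmetric] ennreal_leI flip: ennreal_plus)
      qed
      also have "\<dots> = R m"
        unfolding R_def by (subst nn_integral_add) (auto simp: nn_integral_cmult)
      finally show ?thesis by (simp add: mult_left_mono)
    qed

    have limR: "R \<longlonglongrightarrow> (\<integral>\<^sup>+x. ennreal (\<sigma>' (U x) * norm (G x)) \<partial>lborel)"
    proof -
      have "(\<lambda>m. \<integral>\<^sup>+x. ennreal (\<sigma>' (u m x) * norm (G x)) \<partial>lborel) \<longlonglongrightarrow> (\<integral>\<^sup>+x. ennreal (\<sigma>' (U x) * norm (G x)) \<partial>lborel)"
      proof (rule nn_integral_dominated_convergence[where w="\<lambda>x. ennreal (2 / (l - k) * norm (G x))"])
        show "AE x in lborel. ennreal (\<sigma>' (u m x) * norm (G x)) \<le> ennreal (2 / (l - k) * norm (G x))" for m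
          by (intro AE_I2 ennreal_leI mult_right_mono \<sigma>'2) auto
        show "(\<integral>\<^sup>+x. ennreal (2 / (l - k) * norm (G x)) \<partial>lborel) < \<infinity>"
        proof -
          have "(\<integral>\<^sup>+x. ennreal (2 / (l - k) * norm (G x)) \<partial>lborel) = (\<integral>\<^sup>+x. ennreal (2 / (l - k)) * ennreal (norm (G x)) \<partial>lborel)"
            using kl by (intro nn_integral_cong ennreal_mult) auto
          then show ?thesis
            using G by (simp add: integrable_iff_bounded nn_integral_cmult ennreal_mult_less_top)
        qed
        show "AE x in lborel. (\<lambda>m. ennreal (\<sigma>' (u m x) * norm (G x))) \<longlonglongrightarrow> ennreal (\<sigma>' (U x) * norm (G x))"
          using d(3) by eventually_elim (intro tendsto_ennrealI tendsto_mult lim\<sigma>' tendsto_const)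
      qed measurable
      moreover have "(\<lambda>m. ennreal (2 / (l - k)) * (\<integral>\<^sup>+x. norm (g m x - G x) \<partial>lborel)) \<longlonglongrightarrow> ennreal (2 / (l - k)) * 0"
        unfolding g_def by (intro ennreal_tendsto_cmult d(4)) simp
      ultimately show ?thesis
        unfolding R_def using tendsto_add by fastforce
    qed

    have lim0: "(\<lambda>m. w x z * (B m x * B m z * ennreal \<bar>\<sigma> (u m x) - \<sigma> (u m z)\<bar>)) \<longlonglongrightarrow> w x z * ennreal \<bar>\<sigma> (U x) - \<sigma> (U z)\<bar>"
      if x: "(\<lambda>m. mollify (d m) U x) \<longlonglongrightarrow> U x" and z: "(\<lambda>m. mollify (d m) U z) \<longlonglongrightarrow> U z" for x z
    proof (cases "norm x < r \<and> norm z < r")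
      case True
      have ev: "\<forall>\<^sub>F m in sequentially. B m y = 1" if "norm y < r" for y
      proof -
        have "\<forall>\<^sub>F m in sequentially. d m < r - norm y"
          using order_tendstoD(2)[OF d(2)] that by simp
        then show ?thesis by eventually_elim (simp add: B_def)
      qed
      have "(\<lambda>m. w x z * ennreal \<bar>\<sigma> (u m x) - \<sigma> (u m z)\<bar>) \<longlonglongrightarrow> w x z * ennreal \<bar>\<sigma> (U x) - \<sigma> (U z)\<bar>"
        by (intro ennreal_tendsto_cmult tendsto_ennrealI tendsto_rabs tendsto_diff lim\<sigma> x z) (simp add: w_def)
      moreover have "\<forall>\<^sub>F m in sequentially. w x z * ennreal \<bar>\<sigma> (u m x) - \<sigma> (u m z)\<bar>
          = w x z * (B m x * B m z * ennreal \<bar>\<sigma> (u m x) - \<sigma> (u m z)\<bar>)"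
        using ev[of x] ev[of z] True by (auto elim: eventually_elim2)
      ultimately show ?thesis by (rule Lim_transform_eventually)
    next
      case False
      then have "w x z = 0" by (auto simp: w_def)
      then show ?thesis by simp
    qed
    \<comment> \<open>Fatou is applied twice, here in z at a fixed convergence point x and
      afterwards in x; almost every x is such a point.\<close>
    have inner: "(\<integral>\<^sup>+z. w x z * ennreal \<bar>\<sigma> (U x) - \<sigma> (U z)\<bar> \<partial>lborel) \<le> liminf (\<lambda>m. L m x)"
      if x: "(\<lambda>m. mollify (d m) U x) \<longlonglongrightarrow> U x" for x
    proof -
      have "(\<integral>\<^sup>+z. w x z * ennreal \<bar>\<sigma> (U x) - \<sigma> (U z)\<bar> \<partial>lborel)
          \<le> (\<integral>\<^sup>+z. liminf (\<lambda>m. w x z * (B m x * B m z * ennreal \<bar>\<sigma> (u m x) - \<sigma> (u m z)\<bar>)) \<partial>lborel)"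
        using d(3) by (intro nn_integral_mono_AE, eventually_elim)
          (simp add: lim_imp_Liminf[OF sequentially_bot lim0[OF x]])
      also have "\<dots> \<le> liminf (\<lambda>m. L m x)"
        unfolding L_def by (rule nn_integral_liminf) measurable
      finally show ?thesis .
    qed
    have "(\<integral>\<^sup>+x. \<integral>\<^sup>+z. w x z * ennreal \<bar>\<sigma> (U x) - \<sigma> (U z)\<bar> \<partial>lborel \<partial>lborel) \<le> (\<integral>\<^sup>+x. liminf (\<lambda>m. L m x) \<partial>lborel)"
      using d(3) by (intro nn_integral_mono_AE, eventually_elim) (rule inner)
    also have "\<dots> \<le> liminf (\<lambda>m. \<integral>\<^sup>+x. L m x \<partial>lborel)"
      by (rule nn_integral_liminf) measurable
    also have "\<dots> \<le> liminf (\<lambda>m. C * R m)"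
      by (intro Liminf_mono always_eventually allI bound)
    also have "\<dots> = C * (\<integral>\<^sup>+x. ennreal (\<sigma>' (U x) * norm (G x)) \<partial>lborel)"
      by (intro lim_imp_Liminf sequentially_bot ennreal_tendsto_cmult limR) (simp add: C_def)
    finally show ?thesis
      unfolding w_def \<sigma>_def \<sigma>'_def C_def .
  qed
  with K(1) show ?thesis
    by (intro exI[of _ "2 * K"]) auto
qed

section \<open>Weighted measures\<close>

definition weighted_measure :: "real \<Rightarrow> 'a::euclidean_space \<Rightarrow> 'a set \<Rightarrow> real" where
  "weighted_measure p e S = (\<integral>x. indicator S x * \<bar>x \<bullet> e\<bar> powr p \<partial>lborel)"

text \<open>Integrability comes together with the bound, because the integral of a non-integrable
  function is 0 by convention and the bound alone would carry no information.\<close>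

lemma weighted_measure_ball:
  fixes e :: "'a::euclidean_space"
  assumes "p > -1" "e \<in> Basis"
  shows "\<exists>J>0. \<forall>r>0. \<forall>S\<in>sets borel. S \<subseteq> ball 0 r \<longrightarrow>
    integrable lborel (\<lambda>x. indicator S x * \<bar>x \<bullet> e\<bar> powr p) \<and>
    weighted_measure p e S \<le> J * r powr (real DIM('a) + p)"
proof -
  obtain J where J: "J > 0" "\<And>r. r > 0 \<Longrightarrow>
    (\<integral>\<^sup>+x. ennreal (indicator (cube r) x * \<bar>x \<bullet> e\<bar> powr p) \<partial>lborel) \<le> ennreal (J * r powr (real DIM('a) + p))"
    using nn_integral_powr_cube[OF assms] by blast
  have "integrable lborel (\<lambda>x. indicator S x * \<bar>x \<bullet> e\<bar> powr p) \<and>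
      weighted_measure p e S \<le> J * r powr (real DIM('a) + p)"
    if r: "r > 0" and [measurable]: "S \<in> sets borel" and S: "S \<subseteq> ball 0 r" for r S
  proof -
    have "(\<integral>\<^sup>+x. ennreal (indicator S x * \<bar>x \<bullet> e\<bar> powr p) \<partial>lborel)
        \<le> (\<integral>\<^sup>+x. ennreal (indicator (cube r) x * \<bar>x \<bullet> e\<bar> powr p) \<partial>lborel)"
      using S ball_subset_cube[of r, where 'a='a]
      by (intro nn_integral_mono ennreal_leI) (auto simp: indicator_def)
    also note J(2)[OF r]
    finally have le: "(\<integral>\<^sup>+x. ennreal (indicator S x * \<bar>x \<bullet> e\<bar> powr p) \<partial>lborel) \<le> ennreal (J * r powr (real DIM('a) + p))" .
    have int: "integrable lborel (\<lambda>x. indicator S x * \<bar>x \<bullet> e\<bar> powr p)"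
      using order_le_less_trans[OF le ennreal_less_top] by (intro integrableI_nonneg) auto
    have "ennreal (weighted_measure p e S) \<le> ennreal (J * r powr (real DIM('a) + p))"
      unfolding weighted_measure_def using le by (subst nn_integral_eq_integral[OF int, symmetric]) auto
    with int show ?thesis using J(1) by (simp add: ennreal_le_iff)
  qed
  with J(1) show ?thesis by blast
qed

lemma weighted_measure_nonneg: "0 \<le> weighted_measure p e S"
  by (simp add: weighted_measure_def)

text \<open>On the hyperplane the weight is 0 for every exponent, by \<open>0 powr p = 0\<close>, so
  identities between powers of the weight hold only off this null set.\<close>

lemma AE_inner_nonzero:
  fixes e :: "'a::euclidean_space"
  assumes "e \<in> Basis"
  shows "AE x in lborel. x \<bullet> e \<noteq> 0"
proof -
  have "{x. x \<bullet> e = 0} \<in> null_sets lebesgue"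
    using negligible_standard_hyperplane[OF assms, of 0] by (simp add: negligible_iff_null_sets)
  moreover have "{x. x \<bullet> e = 0} \<in> sets lborel" by simp
  ultimately have "{x. x \<bullet> e = 0} \<in> null_sets lborel"
    by (simp add: null_sets_def emeasure_completion)
  then show ?thesis using AE_not_in by fastforce
qed

text \<open>Hoelder's inequality, obtained by integrating Young's inequality for the two normalised
  weights. The exponent q is the one for which p \<theta> + q (1 - \<theta>) = 0, and \<theta> (p +
  1) < 1 says that q > -1.\<close>

lemma measure_le_weighted_measure:
  fixes e :: "'a::euclidean_space"
  assumes p: "p > -1" "e \<in> Basis" and \<theta>: "0 < \<theta>" "\<theta> < 1" "\<theta> * (p + 1) < 1"
  shows "\<exists>C>0. \<forall>r>0. \<forall>D\<in>sets borel. D \<subseteq> ball 0 r \<longrightarrow>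
    measure lborel D \<le> C * r powr (real DIM('a) * (1 - \<theta>) - \<theta> * p) * weighted_measure p e D powr \<theta>"
proof -
  define q where "q = - \<theta> * p / (1 - \<theta>)"
  have q: "q > -1" using \<theta> by (simp add: q_def field_simps)
  obtain J where J: "J > 0" "\<And>r S. r > 0 \<Longrightarrow> S \<in> sets borel \<Longrightarrow> S \<subseteq> ball 0 r \<Longrightarrow>
      integrable lborel (\<lambda>x. indicator S x * \<bar>x \<bullet> e\<bar> powr q)"
    "\<And>r S. r > 0 \<Longrightarrow> S \<in> sets borel \<Longrightarrow> S \<subseteq> ball 0 r \<Longrightarrow> weighted_measure q e S \<le> J * r powr (real DIM('a) + q)"
    using weighted_measure_ball[OF q p(2)] by blast
  obtain J' where J': "\<And>r S. r > 0 \<Longrightarrow> S \<in> sets borel \<Longrightarrow> S \<subseteq> ball 0 r \<Longrightarrow>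
      integrable lborel (\<lambda>x. indicator S x * \<bar>x \<bullet> e\<bar> powr p)"
    using weighted_measure_ball[OF p] by blast
  have "measure lborel D \<le> J powr (1 - \<theta>) * r powr (real DIM('a) * (1 - \<theta>) - \<theta> * p) * weighted_measure p e D powr \<theta>"
    if r: "r > 0" and D[measurable]: "D \<in> sets borel" "D \<subseteq> ball 0 r" for r D
  proof -
    define X where "X = weighted_measure p e D"
    \<comment> \<open>The upper bound for the mass of the dual weight, not the mass itself: it is
      positive even if D is null, so dividing by it is safe.\<close>
    define Y where "Y = J * r powr (real DIM('a) + q)"
    have Y: "Y > 0" using J(1) r by (simp add: Y_def)
    have Yp: "Y powr (1 - \<theta>) = J powr (1 - \<theta>) * r powr (real DIM('a) * (1 - \<theta>) - \<theta> * p)"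
    proof -
      have "(real DIM('a) + q) * (1 - \<theta>) = real DIM('a) * (1 - \<theta>) - \<theta> * p"
      proof -
        have "q * (1 - \<theta>) = - \<theta> * p" using \<theta> by (simp add: q_def)
        then show ?thesis by (simp add: distrib_right)
      qed
      then show ?thesis using J(1) r by (simp add: Y_def powr_mult powr_powr)
    qed
    have "emeasure lborel D \<le> emeasure lborel (ball (0::'a) r)"
      using D by (intro emeasure_mono) auto
    then have fin: "emeasure lborel D < \<infinity>"
      using emeasure_lborel_ball_finite[of "0::'a" r] by (simp add: order_le_less_trans)
    have intD: "integrable lborel (indicator D :: 'a \<Rightarrow> real)" using fin by simp
    have mD: "measure lborel D = (\<integral>x. indicator D x \<partial>lborel)" by simp
    have "measure lborel D \<le> Y powr (1 - \<theta>) * X powr \<theta>"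
    \<comment> \<open>Normalising needs X > 0. If X = 0, the weight vanishes almost everywhere on D,
      but it is nonzero off the hyperplane, so D is null.\<close>
    proof (cases "X = 0")
      case True
      have "AE x in lborel. indicator D x * \<bar>x \<bullet> e\<bar> powr p = 0"
        using True integral_nonneg_eq_0_iff_AE[OF J'[OF r D]] by (simp add: X_def weighted_measure_def)
      with AE_inner_nonzero[OF p(2)] have "AE x in lborel. x \<notin> D"
        by eventually_elim (auto simp: indicator_def split: if_splits)
      then have "emeasure lborel D = 0"
        by (subst (asm) AE_iff_measurable[of D]) auto
      then show ?thesis by (simp add: measure_def)
    next
      case False
      then have X: "X > 0" using weighted_measure_nonneg[of p e D] by (simp add: X_def)
      \<comment> \<open>The value to be reached: the two integrated summands are at most c \<theta>
        and c (1 - \<theta>).\<close>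
      define c where "c = X powr \<theta> * Y powr (1 - \<theta>)"
      have c: "c > 0" using X Y by (simp add: c_def)
      have "(\<integral>x. indicator D x \<partial>lborel) \<le> (\<integral>x. c * \<theta> / X * (indicator D x * \<bar>x \<bullet> e\<bar> powr p) + c * (1 - \<theta>) / Y * (indicator D x * \<bar>x \<bullet> e\<bar> powr q) \<partial>lborel)"
      proof (rule integral_mono_AE)
        show "AE x in lborel. indicator D x \<le> c * \<theta> / X * (indicator D x * \<bar>x \<bullet> e\<bar> powr p) + c * (1 - \<theta>) / Y * (indicator D x * \<bar>x \<bullet> e\<bar> powr q)"
          using AE_inner_nonzero[OF p(2)]
        proof eventually_elim
          fix x :: 'a assume x: "x \<bullet> e \<noteq> 0"
          define a where "a = \<bar>x \<bullet> e\<bar> powr p / X"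
          define b where "b = \<bar>x \<bullet> e\<bar> powr q / Y"
          have ab: "a > 0" "b > 0" using x X Y by (auto simp: a_def b_def)
          have "c * (a powr \<theta> * b powr (1 - \<theta>)) = \<bar>x \<bullet> e\<bar> powr (p * \<theta>) * \<bar>x \<bullet> e\<bar> powr (q * (1 - \<theta>))"
            using X Y by (simp add: c_def a_def b_def powr_divide powr_powr)
          also have "\<dots> = 1"
            using x \<theta> by (simp add: powr_add[symmetric] q_def)
          finally have "1 \<le> c * (\<theta> * a + (1 - \<theta>) * b)"
            using Youngs_inequality_0[of \<theta> "1 - \<theta>" a b] \<theta> ab c by (metis diff_ge_0_iff_ge less_eq_real_def mult_left_mono add_diff_cancel_left' add.commute diff_add_cancel)
          then show "indicator D x \<le> c * \<theta> / X * (indicator D x * \<bar>x \<bullet> e\<bar> powr p) + c * (1 - \<theta>) / Y * (indicator D x * \<bar>x \<bullet> e\<bar> powr q)"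
            by (simp add: indicator_def a_def b_def distrib_left mult.assoc)
        qed
      qed (intro Bochner_Integration.integrable_add Bochner_Integration.integrable_mult_right J'[OF r D] J(2)[OF r D] intD)+
      also have "\<dots> = c * \<theta> / X * X + c * (1 - \<theta>) / Y * weighted_measure q e D"
        by (simp add: X_def weighted_measure_def J'[OF r D] J(2)[OF r D])
      also have "\<dots> \<le> c * \<theta> / X * X + c * (1 - \<theta>) / Y * Y"
        using J(3)[OF r D] c Y \<theta> by (intro add_left_mono mult_left_mono) (auto simp: Y_def)
      also have "\<dots> = c" using X Y by (simp add: right_diff_distrib)
      finally show ?thesis by (simp add: c_def mult.commute)
    qed
    then show ?thesis by (simp add: Yp X_def)
  qed
  then show ?thesis using J(1) by (intro exI[of _ "J powr (1 - \<theta>)"]) auto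
qed

section \<open>The isoperimetric inequality\<close>

lemma ball_measure_eq:
  assumes "r > 0"
  shows "emeasure lborel (ball (0::'a::euclidean_space) r) = ennreal (unit_ball_vol (real DIM('a)) * r powr real DIM('a))"
  using emeasure_ball[of r "0::'a"] assms by (simp add: powr_realpow)

text \<open>Integrating the weighted difference over x in A alone gives a \<bar>1 - V z\<bar>, over
  x in B alone b \<bar>V z\<bar>. Multiplying the first by b, the second by a, and adding yields a b
  at every z, to be integrated over the ball.\<close>

lemma isoperimetric_mass_bound:
  fixes e :: "'a::euclidean_space" and V :: "'a \<Rightarrow> real"
  assumes [measurable]: "A \<in> sets borel" "B \<in> sets borel" "V \<in> borel_measurable borel"
    and AB: "A \<subseteq> ball 0 r" "B \<subseteq> ball 0 r"
    and V: "\<And>x. x \<in> A \<Longrightarrow> V x = 1" "\<And>x. x \<in> B \<Longrightarrow> V x = 0"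
    and intA: "integrable lborel (\<lambda>x. indicator A x * \<bar>x \<bullet> e\<bar> powr p)"
    and intB: "integrable lborel (\<lambda>x. indicator B x * \<bar>x \<bullet> e\<bar> powr p)"
  defines "a \<equiv> weighted_measure p e A" and "b \<equiv> weighted_measure p e B"
  shows "ennreal (a * b) * emeasure lborel (ball (0::'a) r) \<le> ennreal (a + b) *
    (\<integral>\<^sup>+x. \<integral>\<^sup>+z. ennreal (indicator (ball 0 r) z * (indicator (ball 0 r) x * \<bar>x \<bullet> e\<bar> powr p)) * ennreal \<bar>V x - V z\<bar> \<partial>lborel \<partial>lborel)"
proof -
  define w where "w x = ennreal (indicator (ball 0 r) x * \<bar>x \<bullet> e\<bar> powr p)" for x :: 'a
  define F where "F z = (\<integral>\<^sup>+x. w x * ennreal \<bar>V x - V z\<bar> \<partial>lborel)" for z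
  have [measurable]: "w \<in> borel_measurable borel" unfolding w_def[abs_def] by measurable
  have [measurable]: "F \<in> borel_measurable borel" unfolding F_def[abs_def] by measurable
  have a0: "a \<ge> 0" and b0: "b \<ge> 0" by (simp_all add: a_def b_def weighted_measure_nonneg)
  have nna: "(\<integral>\<^sup>+x. ennreal (indicator A x * \<bar>x \<bullet> e\<bar> powr p) \<partial>lborel) = ennreal a"
    unfolding a_def weighted_measure_def by (intro nn_integral_eq_integral intA) simp
  have nnb: "(\<integral>\<^sup>+x. ennreal (indicator B x * \<bar>x \<bullet> e\<bar> powr p) \<partial>lborel) = ennreal b"
    unfolding b_def weighted_measure_def by (intro nn_integral_eq_integral intB) simp
  have Fa: "ennreal (a * \<bar>1 - V z\<bar>) \<le> F z" for z
  proof -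
    have "ennreal (a * \<bar>1 - V z\<bar>) = (\<integral>\<^sup>+x. ennreal (indicator A x * \<bar>x \<bullet> e\<bar> powr p) * ennreal \<bar>1 - V z\<bar> \<partial>lborel)"
      using a0 by (subst nn_integral_multc) (simp, simp only: nna, simp add: ennreal_mult)
    also have "\<dots> \<le> F z"
      unfolding F_def w_def using AB V by (intro nn_integral_mono) (auto simp: indicator_def)
    finally show ?thesis .
  qed
  have Fb: "ennreal (b * \<bar>V z\<bar>) \<le> F z" for z
  proof -
    have "ennreal (b * \<bar>V z\<bar>) = (\<integral>\<^sup>+x. ennreal (indicator B x * \<bar>x \<bullet> e\<bar> powr p) * ennreal \<bar>V z\<bar> \<partial>lborel)"
      using b0 by (subst nn_integral_multc) (simp, simp only: nnb, simp add: ennreal_mult)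
    also have "\<dots> \<le> F z"
      unfolding F_def w_def using AB V by (intro nn_integral_mono) (auto simp: indicator_def)
    finally show ?thesis .
  qed
  have pt: "ennreal (a * b) \<le> ennreal (a + b) * F z" for z
  proof -
    have "a * b \<le> b * (a * \<bar>1 - V z\<bar>) + a * (b * \<bar>V z\<bar>)"
    proof -
      have "a * b * 1 \<le> a * b * (\<bar>1 - V z\<bar> + \<bar>V z\<bar>)"
        using a0 b0 by (intro mult_left_mono) auto
      then show ?thesis by (simp add: algebra_simps)
    qed
    then have "ennreal (a * b) \<le> ennreal (b * (a * \<bar>1 - V z\<bar>) + a * (b * \<bar>V z\<bar>))"
      by (rule ennreal_leI)
    also have "\<dots> = ennreal b * ennreal (a * \<bar>1 - V z\<bar>) + ennreal a * ennreal (b * \<bar>V z\<bar>)"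
      using a0 b0 by (simp add: ennreal_mult)
    also have "\<dots> \<le> ennreal b * F z + ennreal a * F z"
      by (intro add_mono mult_left_mono Fa Fb) auto
    also have "\<dots> = ennreal (a + b) * F z"
      using a0 b0 by (simp add: distrib_right add.commute)
    finally show ?thesis .
  qed
  have "ennreal (a * b) * emeasure lborel (ball (0::'a) r) = (\<integral>\<^sup>+z. ennreal (a * b) * indicator (ball (0::'a) r) z \<partial>lborel)"
    by (simp add: nn_integral_cmult_indicator)
  also have "\<dots> \<le> (\<integral>\<^sup>+z. ennreal (a + b) * (indicator (ball 0 r) z * F z) \<partial>lborel)"
    using pt by (intro nn_integral_mono) (auto simp: indicator_def)
  also have "\<dots> = ennreal (a + b) * (\<integral>\<^sup>+z. indicator (ball 0 r) z * F z \<partial>lborel)"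
    by (rule nn_integral_cmult) simp
  also have "(\<integral>\<^sup>+z. indicator (ball 0 r) z * F z \<partial>lborel)
      = (\<integral>\<^sup>+z. \<integral>\<^sup>+x. indicator (ball 0 r) z * (w x * ennreal \<bar>V x - V z\<bar>) \<partial>lborel \<partial>lborel)"
    unfolding F_def by (intro nn_integral_cong nn_integral_cmult[symmetric]) simp
  also have "\<dots> = (\<integral>\<^sup>+x. \<integral>\<^sup>+z. indicator (ball 0 r) z * (w x * ennreal \<bar>V x - V z\<bar>) \<partial>lborel \<partial>lborel)"
    by (rule lborel_pair.Fubini') simp
  also have "\<dots> = (\<integral>\<^sup>+x. \<integral>\<^sup>+z. ennreal (indicator (ball 0 r) z * (indicator (ball 0 r) x * \<bar>x \<bullet> e\<bar> powr p)) * ennreal \<bar>V x - V z\<bar> \<partial>lborel \<partial>lborel)"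
    by (intro nn_integral_cong) (simp add: w_def ennreal_mult ennreal_indicator mult.assoc)
  finally show ?thesis .
qed

lemma L1_le_L2_measure:
  fixes G :: "'a::euclidean_space \<Rightarrow> 'b::euclidean_space"
  assumes [measurable]: "G \<in> borel_measurable borel" and G2: "integrable lborel (\<lambda>x. (norm (G x))\<^sup>2)"
    and [measurable]: "D \<in> sets borel" and D: "emeasure lborel D < \<infinity>"
  shows "(\<integral>\<^sup>+x. ennreal (indicator D x * norm (G x)) \<partial>lborel)
    \<le> ennreal (((\<integral>x. indicator D x * (norm (G x))\<^sup>2 \<partial>lborel) * measure lborel D) powr (1/2))"
proof -
  define X where "X = (\<integral>x. indicator D x * (norm (G x))\<^sup>2 \<partial>lborel)"
  define N where "N = (\<integral>\<^sup>+x. ennreal (indicator D x * norm (G x)) \<partial>lborel)"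
  have X0: "X \<ge> 0" by (simp add: X_def)
  have intX: "integrable lborel (\<lambda>x. indicator D x * (norm (G x))\<^sup>2)"
    using integrable_mult_indicator[OF _ G2, of D] by simp
  have nnX: "(\<integral>\<^sup>+x. ennreal (indicator D x * (norm (G x))\<^sup>2) \<partial>lborel) = ennreal X"
    unfolding X_def by (intro nn_integral_eq_integral intX) simp
  have eD: "emeasure lborel D = ennreal (measure lborel D)"
    using D by (simp add: emeasure_eq_ennreal_measure less_top)
  \<comment> \<open>The indicator is idempotent, so a copy can be split off as the second
    Cauchy-Schwarz factor, whose square integrates to the measure of D.\<close>
  have "N\<^sup>2 = (\<integral>\<^sup>+x. ennreal (indicator D x * norm (G x)) * indicator D x \<partial>lborel)\<^sup>2"
    unfolding N_def by (intro arg_cong[of _ _ "\<lambda>x. x\<^sup>2"] nn_integral_cong) (auto simp: indicator_def)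
  also have "\<dots> \<le> (\<integral>\<^sup>+x. (ennreal (indicator D x * norm (G x)))\<^sup>2 \<partial>lborel) * (\<integral>\<^sup>+x. (indicator D x)\<^sup>2 \<partial>lborel)"
    by (rule Cauchy_Schwarz_nn_integral) auto
  also have "(\<integral>\<^sup>+x. (ennreal (indicator D x * norm (G x)))\<^sup>2 \<partial>lborel) = ennreal X"
    unfolding nnX[symmetric] by (intro nn_integral_cong) (auto simp: indicator_def ennreal_power)
  also have "(\<integral>\<^sup>+x. (indicator D x)\<^sup>2 \<partial>lborel) = emeasure lborel D"
  proof -
    have "(\<integral>\<^sup>+x. (indicator D x)\<^sup>2 \<partial>lborel) = (\<integral>\<^sup>+x. indicator D x \<partial>lborel)"
      by (intro nn_integral_cong) (auto simp: indicator_def)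
    then show ?thesis by simp
  qed
  finally have N2: "N\<^sup>2 \<le> ennreal (X * measure lborel D)"
    using X0 by (simp add: eD ennreal_mult)
  then have "N\<^sup>2 < top" by (rule order_le_less_trans) simp
  then have "N < top" by (simp add: power_less_top_ennreal)
  then obtain n where n: "N = ennreal n" "n \<ge> 0" by (cases N) auto
  have "n\<^sup>2 \<le> X * measure lborel D"
    using N2 X0 n by (simp add: ennreal_power ennreal_le_iff)
  then have "n \<le> sqrt (X * measure lborel D)" by (rule real_le_rsqrt)
  then show ?thesis
    using X0 n by (simp add: N_def[symmetric] X_def[symmetric] powr_half_sqrt ennreal_leI)
qed

lemma weighted_isoperimetric_borel:
  fixes e :: "'a::euclidean_space"
  assumes p: "p > -1" "e \<in> Basis" and eps: "0 < \<epsilon>" "\<epsilon> < min (1/2) (1 / (2 * (p + 1)))"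
  shows "\<exists>C>0. \<forall>(k::real) (l::real) (r::real) (U :: 'a \<Rightarrow> real) (G :: 'a \<Rightarrow> 'a).
    k < l \<longrightarrow> r > 0 \<longrightarrow> integrable lborel U \<longrightarrow> integrable lborel G \<longrightarrow>
    integrable lborel (\<lambda>x. (norm (G x))\<^sup>2) \<longrightarrow> (\<forall>x. x \<notin> ball 0 r \<longrightarrow> G x = 0) \<longrightarrow> weak_gradient (ball 0 r) U G \<longrightarrow>
      (l - k) * weighted_measure p e {x \<in> ball 0 r. U x \<ge> l} * weighted_measure p e {x \<in> ball 0 r. U x \<le> k}
      \<le> C * r powr (real DIM('a) + 2 * p + 1 + real DIM('a) * (1 - 2 * \<epsilon>) / 2 - \<epsilon> * p)
        * (\<integral>x. indicator {x \<in> ball 0 r. k < U x \<and> U x < l} x * (norm (G x))\<^sup>2 \<partial>lborel) powr (1/2)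
        * weighted_measure p e {x \<in> ball 0 r. k < U x \<and> U x < l} powr \<epsilon>"
proof -
  let ?n = "real DIM('a)"
  \<comment> \<open>Cauchy-Schwarz takes a square root of the measure of D, so Hoelder is used with
    twice the desired exponent.\<close>
  define \<theta> where "\<theta> = 2 * \<epsilon>"
  have \<theta>: "0 < \<theta>" "\<theta> < 1" "\<theta> * (p + 1) < 1"
    using eps p by (auto simp: \<theta>_def field_simps)
  obtain J where J: "J > 0" "\<And>r S. r > 0 \<Longrightarrow> S \<in> sets borel \<Longrightarrow> S \<subseteq> ball 0 r \<Longrightarrow>
      integrable lborel (\<lambda>x. indicator S x * \<bar>x \<bullet> e\<bar> powr p)"
    "\<And>r S. r > 0 \<Longrightarrow> S \<in> sets borel \<Longrightarrow> S \<subseteq> ball 0 r \<Longrightarrow> weighted_measure p e S \<le> J * r powr (?n + p)"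
    using weighted_measure_ball[OF p] by blast
  obtain M where M: "M > 0" "\<And>r D. r > 0 \<Longrightarrow> D \<in> sets borel \<Longrightarrow> D \<subseteq> ball 0 r \<Longrightarrow>
      measure lborel D \<le> M * r powr (?n * (1 - \<theta>) - \<theta> * p) * weighted_measure p e D powr \<theta>"
    using measure_le_weighted_measure[OF p \<theta>] by blast
  obtain K where K: "K > 0" "\<And>k l r U G. k < l \<Longrightarrow> r > 0 \<Longrightarrow> integrable lborel U \<Longrightarrow> integrable lborel G \<Longrightarrow>
    weak_gradient (ball (0::'a) r) U G \<Longrightarrow>
    (\<integral>\<^sup>+x. \<integral>\<^sup>+z. ennreal (indicator (ball 0 r) z * (indicator (ball 0 r) x * \<bar>x \<bullet> e\<bar> powr p)) *
        ennreal \<bar>step ((U x - k) / (l - k)) - step ((U z - k) / (l - k))\<bar> \<partial>lborel \<partial>lborel)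
    \<le> ennreal (K * r powr (?n + p + 1)) * (\<integral>\<^sup>+x. ennreal (step' ((U x - k) / (l - k)) / (l - k) * norm (G x)) \<partial>lborel)"
    using truncated_poincare[OF p] by blast
  define v where "v = unit_ball_vol ?n"
  have v: "v > 0" by (simp add: v_def)
  \<comment> \<open>The 4 is 2 from a + b \<le> 2 J r^(n+p) times 2 from the peak of
    \<open>step'\<close>. \<open>K\<close> is the segment constant, \<open>M\<close> the Hoelder
    constant under the square root, and \<open>v\<close> the volume of the unit ball, divided out on
    the left.\<close>
  define C where "C = 4 * J * K * M powr (1/2) / v"
  have "C > 0" using J(1) K(1) M(1) v by (simp add: C_def)
  have "(l - k) * weighted_measure p e {x \<in> ball 0 r. U x \<ge> l} * weighted_measure p e {x \<in> ball 0 r. U x \<le> k}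
      \<le> C * r powr (?n + 2 * p + 1 + ?n * (1 - 2 * \<epsilon>) / 2 - \<epsilon> * p)
        * (\<integral>x. indicator {x \<in> ball 0 r. k < U x \<and> U x < l} x * (norm (G x))\<^sup>2 \<partial>lborel) powr (1/2)
        * weighted_measure p e {x \<in> ball 0 r. k < U x \<and> U x < l} powr \<epsilon>"
    if kl: "k < l" and r: "r > 0" and U: "integrable lborel U" and G: "integrable lborel G"
      and G2: "integrable lborel (\<lambda>x. (norm (G x))\<^sup>2)" and G0: "\<And>x. x \<notin> ball 0 r \<Longrightarrow> G x = 0"
      and weak: "weak_gradient (ball 0 r) U G"
    for k l r :: real and U :: "'a \<Rightarrow> real" and G :: "'a \<Rightarrow> 'a"
  proof -
    have [measurable]: "U \<in> borel_measurable borel" "G \<in> borel_measurable borel" using U G by auto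
    define A where "A = {x \<in> ball 0 r. U x \<ge> l}"
    define B where "B = {x \<in> ball 0 r. U x \<le> k}"
    define D where "D = {x \<in> ball 0 r. k < U x \<and> U x < l}"
    have sets[measurable]: "A \<in> sets borel" "B \<in> sets borel" "D \<in> sets borel"
      unfolding A_def B_def D_def by measurable
    have sub: "A \<subseteq> ball 0 r" "B \<subseteq> ball 0 r" "D \<subseteq> ball 0 r" by (auto simp: A_def B_def D_def)
    define a where "a = weighted_measure p e A"
    define b where "b = weighted_measure p e B"
    define X where "X = (\<integral>x. indicator D x * (norm (G x))\<^sup>2 \<partial>lborel)"
    define Y where "Y = weighted_measure p e D"
    define V where "V x = step ((U x - k) / (l - k))" for x
    have a: "0 \<le> a" "a \<le> J * r powr (?n + p)" and b: "0 \<le> b" "b \<le> J * r powr (?n + p)"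
      and Y0: "0 \<le> Y" and X0: "0 \<le> X"
      by (auto simp: a_def b_def X_def Y_def weighted_measure_nonneg intro!: J(3) r sets sub)
    have [measurable]: "V \<in> borel_measurable borel" unfolding V_def[abs_def] by measurable
    have VA: "V x = 1" if "x \<in> A" for x
      using that kl unfolding V_def by (intro step_eq_1) (simp add: A_def)
    have VB: "V x = 0" if "x \<in> B" for x
      using that kl unfolding V_def by (intro step_eq_0) (simp add: B_def divide_nonpos_pos)
    have fin: "emeasure lborel D < \<infinity>"
    proof -
      have "emeasure lborel D \<le> emeasure lborel (ball (0::'a) r)"
        using sub by (intro emeasure_mono) auto
      then show ?thesis
        using emeasure_lborel_ball_finite[of "0::'a" r] by (simp add: order_le_less_trans)
    qed
    have grad: "(\<integral>\<^sup>+x. ennreal (step' ((U x - k) / (l - k)) / (l - k) * norm (G x)) \<partial>lborel)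
        \<le> ennreal (2 / (l - k) * (X * measure lborel D) powr (1/2))"
    proof -
      have "(\<integral>\<^sup>+x. ennreal (step' ((U x - k) / (l - k)) / (l - k) * norm (G x)) \<partial>lborel)
          \<le> (\<integral>\<^sup>+x. ennreal (2 / (l - k)) * ennreal (indicator D x * norm (G x)) \<partial>lborel)"
      proof (rule nn_integral_mono)
        fix x
        have "step' ((U x - k) / (l - k)) / (l - k) * norm (G x) \<le> 2 / (l - k) * (indicator D x * norm (G x))"
        proof (cases "x \<in> D")
          case True
          then show ?thesis using kl step'_bounds(2)[of "(U x - k) / (l - k)"]
            by (auto intro!: mult_right_mono divide_right_mono)
        next
          case False
          \<comment> \<open>Outside the ball G vanishes; inside it, leaving D means leaving the
            interval on which the truncation moves.\<close>
          then have "G x = 0 \<or> step' ((U x - k) / (l - k)) = 0"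
            using G0[of x] kl by (cases "x \<in> ball 0 r") (auto simp: D_def not_less divide_nonpos_pos intro!: step'_eq_0)
          with False show ?thesis by auto
        qed
        then show "ennreal (step' ((U x - k) / (l - k)) / (l - k) * norm (G x))
            \<le> ennreal (2 / (l - k)) * ennreal (indicator D x * norm (G x))"
          using kl by (simp add: ennreal_mult[symmetric] ennreal_leI del: times_divide_eq_left)
      qed
      also have "\<dots> = ennreal (2 / (l - k)) * (\<integral>\<^sup>+x. ennreal (indicator D x * norm (G x)) \<partial>lborel)"
        by (rule nn_integral_cmult) simp
      also have "\<dots> \<le> ennreal (2 / (l - k)) * ennreal ((X * measure lborel D) powr (1/2))"
        unfolding X_def by (intro mult_left_mono L1_le_L2_measure G2 fin) auto
      also have "\<dots> = ennreal (2 / (l - k) * (X * measure lborel D) powr (1/2))"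
        using kl by (simp add: ennreal_mult[symmetric])
      finally show ?thesis .
    qed
    have "ennreal (a * b) * ennreal (v * r powr ?n) \<le> ennreal (a + b) *
        (ennreal (K * r powr (?n + p + 1)) * ennreal (2 / (l - k) * (X * measure lborel D) powr (1/2)))"
    proof -
      have "ennreal (a * b) * emeasure lborel (ball (0::'a) r) \<le> ennreal (a + b) *
          (\<integral>\<^sup>+x. \<integral>\<^sup>+z. ennreal (indicator (ball 0 r) z * (indicator (ball 0 r) x * \<bar>x \<bullet> e\<bar> powr p)) * ennreal \<bar>V x - V z\<bar> \<partial>lborel \<partial>lborel)"
        unfolding a_def b_def
        by (rule isoperimetric_mass_bound) (use sub VA VB J(2)[OF r] in auto)
      also have "\<dots> \<le> ennreal (a + b) * (ennreal (K * r powr (?n + p + 1)) *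
          ennreal (2 / (l - k) * (X * measure lborel D) powr (1/2)))"
        unfolding V_def by (intro mult_left_mono order_trans[OF K(2)[OF kl r U G weak]] grad) auto
      finally show ?thesis by (simp add: ball_measure_eq[OF r] v_def)
    qed
    also have "\<dots> = ennreal ((a + b) * (K * r powr (?n + p + 1) * (2 / (l - k) * (X * measure lborel D) powr (1/2))))"
      using a b K(1) kl by (simp add: ennreal_mult[symmetric] del: ennreal_plus)
    also have "ennreal (a * b) * ennreal (v * r powr ?n) = ennreal (a * b * (v * r powr ?n))"
      using a b v by (simp add: ennreal_mult)
    finally have "a * b * (v * r powr ?n) \<le> (a + b) * (K * r powr (?n + p + 1) * (2 / (l - k) * (X * measure lborel D) powr (1/2)))"
      using a b K(1) kl by (subst (asm) ennreal_le_iff) auto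
    also have "\<dots> \<le> (2 * (J * r powr (?n + p))) * (K * r powr (?n + p + 1) * (2 / (l - k) * (X * measure lborel D) powr (1/2)))"
      using a b K(1) kl by (intro mult_right_mono) auto
    also have "\<dots> \<le> (2 * (J * r powr (?n + p))) * (K * r powr (?n + p + 1) * (2 / (l - k) *
        (X powr (1/2) * (M powr (1/2) * r powr ((?n * (1 - \<theta>) - \<theta> * p) / 2) * Y powr \<epsilon>))))"
    proof -
      have "(X * measure lborel D) powr (1/2) \<le> (X * (M * r powr (?n * (1 - \<theta>) - \<theta> * p) * Y powr \<theta>)) powr (1/2)"
        using M(2)[OF r sets(3) sub(3)] X0 unfolding Y_def by (intro powr_mono2 mult_left_mono) auto
      also have "\<dots> = X powr (1/2) * (M powr (1/2) * r powr ((?n * (1 - \<theta>) - \<theta> * p) / 2) * Y powr \<epsilon>)"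
        using X0 M(1) r Y0 by (simp add: powr_mult powr_powr \<theta>_def)
      finally show ?thesis
        using J(1) K(1) kl by (intro mult_left_mono) auto
    qed
    finally have *: "a * b * (v * r powr ?n) \<le> (2 * (J * r powr (?n + p))) * (K * r powr (?n + p + 1) * (2 / (l - k) *
        (X powr (1/2) * (M powr (1/2) * r powr ((?n * (1 - \<theta>) - \<theta> * p) / 2) * Y powr \<epsilon>))))" .
    \<comment> \<open>The factor r^n is kept apart to be cancelled against the volume of the ball on
      the left.\<close>
    have expo: "r powr (?n + p) * (r powr (?n + p + 1) * r powr ((?n * (1 - \<theta>) - \<theta> * p) / 2))
        = r powr ?n * r powr (?n + 2 * p + 1 + ?n * (1 - 2 * \<epsilon>) / 2 - \<epsilon> * p)"
      by (simp only: powr_add[symmetric]) (simp add: \<theta>_def field_simps)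
    have "(l - k) * (a * b * (v * r powr ?n)) \<le> (l - k) * ((2 * (J * r powr (?n + p))) * (K * r powr (?n + p + 1) * (2 / (l - k) *
        (X powr (1/2) * (M powr (1/2) * r powr ((?n * (1 - \<theta>) - \<theta> * p) / 2) * Y powr \<epsilon>)))))"
      using * kl by (intro mult_left_mono) auto
    also have "\<dots> = 4 * J * K * M powr (1/2) * (r powr (?n + p) * (r powr (?n + p + 1) * r powr ((?n * (1 - \<theta>) - \<theta> * p) / 2)))
        * X powr (1/2) * Y powr \<epsilon>"
      using kl by simp
    also have "\<dots> = (C * r powr (?n + 2 * p + 1 + ?n * (1 - 2 * \<epsilon>) / 2 - \<epsilon> * p) * X powr (1/2) * Y powr \<epsilon>) * (v * r powr ?n)"
      unfolding expo using v by (simp add: C_def)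
    finally have "((l - k) * a * b) * (v * r powr ?n)
        \<le> (C * r powr (?n + 2 * p + 1 + ?n * (1 - 2 * \<epsilon>) / 2 - \<epsilon> * p) * X powr (1/2) * Y powr \<epsilon>) * (v * r powr ?n)"
      by (simp only: mult.assoc)
    then have "(l - k) * a * b \<le> C * r powr (?n + 2 * p + 1 + ?n * (1 - 2 * \<epsilon>) / 2 - \<epsilon> * p) * X powr (1/2) * Y powr \<epsilon>"
      using v r by (subst (asm) mult_le_cancel_right) auto
    then show ?thesis
      unfolding a_def b_def X_def Y_def A_def B_def D_def .
  qed
  with \<open>C > 0\<close> show ?thesis by (intro exI[of _ C]) blast
qed

section \<open>Borel representatives and the passage back to Lebesgue measure\<close>

lemma L2_on_ball_measurable:
  fixes f :: "'a::euclidean_space \<Rightarrow> 'b::euclidean_space"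
  assumes "f \<in> L2_on (ball 0 r)"
  shows "(\<lambda>x. if x \<in> ball 0 r then f x else 0) \<in> borel_measurable lebesgue"
  using assms by (subst borel_measurable_if) (auto simp: L2_on_def)

text \<open>Borel representatives are taken coordinate by coordinate, from the real-valued case, and
  reassembled. Integrability of F follows from square-integrability because the ball has finite
  measure.\<close>

lemma L2_on_ball_borel_representative:
  fixes f :: "'a::euclidean_space \<Rightarrow> 'b::euclidean_space"
  assumes f: "f \<in> L2_on (ball 0 r)"
  obtains F where "F \<in> borel_measurable borel" "\<And>x. x \<notin> ball 0 r \<Longrightarrow> F x = 0"
    "AE x in lborel. (if x \<in> ball 0 r then f x else 0) = F x"
    "integrable lborel F" "integrable lborel (\<lambda>x. (norm (F x))\<^sup>2)"
proof -
  define f0 where "f0 x = (if x \<in> ball 0 r then f x else 0)" for x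
  have f0[measurable]: "f0 \<in> borel_measurable lebesgue"
    unfolding f0_def[abs_def] by (rule L2_on_ball_measurable[OF f])
  have "\<exists>h. h \<in> borel_measurable borel \<and> (AE x in lborel. f0 x \<bullet> b = h x)" for b
    using completion_ex_borel_measurable_real[of "\<lambda>x. f0 x \<bullet> b" lborel] by auto
  from choice[OF allI[OF this]] obtain h where
    "\<forall>b. h b \<in> borel_measurable borel \<and> (AE x in lborel. f0 x \<bullet> b = h b x)" ..
  then have h: "h b \<in> borel_measurable borel" "AE x in lborel. f0 x \<bullet> b = h b x" for b by simp_all
  note h(1)[measurable]
  \<comment> \<open>The indicator makes F vanish at every point outside the ball, not merely at
    almost every one.\<close>
  define F where "F x = indicator (ball 0 r) x *\<^sub>R (\<Sum>b\<in>Basis. h b x *\<^sub>R b)" for x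
  have F[measurable]: "F \<in> borel_measurable borel" unfolding F_def[abs_def] by measurable
  have "AE x in lborel. \<forall>b\<in>Basis. f0 x \<bullet> b = h b x"
    using h(2) by (intro AE_finite_allI) auto
  then have AE: "AE x in lborel. f0 x = F x"
  proof eventually_elim
    fix x assume "\<forall>b\<in>Basis. f0 x \<bullet> b = h b x"
    then have "(\<Sum>b\<in>Basis. h b x *\<^sub>R b) = f0 x"
      by (subst euclidean_representation[of "f0 x", symmetric]) (auto intro!: sum.cong)
    then show "f0 x = F x" by (simp add: F_def f0_def)
  qed
  have "integrable lebesgue (\<lambda>x. indicator (ball 0 r) x *\<^sub>R (norm (f x))\<^sup>2)"
    using f by (simp add: L2_on_def integrable_restrict_space)
  also have "(\<lambda>x. indicator (ball 0 r) x *\<^sub>R (norm (f x))\<^sup>2) = (\<lambda>x. (norm (f0 x))\<^sup>2)"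
    by (auto simp: f0_def)
  finally have "integrable lebesgue (\<lambda>x. (norm (f0 x))\<^sup>2)" .
  moreover have "AE x in lebesgue. (norm (f0 x))\<^sup>2 = (norm (F x))\<^sup>2"
    using AE_completion[OF AE] by eventually_elim simp
  ultimately have "integrable lebesgue (\<lambda>x. (norm (F x))\<^sup>2)"
    by (subst (asm) integrable_cong_AE) (auto simp: measurable_completion)
  then have F2: "integrable lborel (\<lambda>x. (norm (F x))\<^sup>2)"
    by (simp add: integrable_completion)
  have "integrable lborel (\<lambda>x. indicator (ball 0 r) x + (norm (F x))\<^sup>2)"
    using emeasure_lborel_ball_finite[of "0::'a" r] by (intro Bochner_Integration.integrable_add F2) simp
  then have F1: "integrable lborel F"
  proof (rule Bochner_Integration.integrable_bound)
    have "norm (F x) \<le> indicator (ball 0 r) x + (norm (F x))\<^sup>2" for x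
    proof (cases "x \<in> ball 0 r")
      case True
      \<comment> \<open>Completing the square: s \<le> s^2 + 1/4 for s the norm of F x, and 1/4 is
        below the indicator.\<close>
      have "0 \<le> (norm (F x) - 1/2)\<^sup>2" by simp
      then show ?thesis using True by (simp add: power2_eq_square algebra_simps)
    qed (simp add: F_def)
    then show "AE x in lborel. norm (F x) \<le> norm (indicator (ball 0 r) x + (norm (F x))\<^sup>2)"
      by (intro AE_I2) (simp add: abs_of_nonneg)
  qed simp
  show thesis
    by (rule that[of F]) (use F AE F1 F2 in \<open>auto simp: F_def f0_def\<close>)
qed

text \<open>The bridge from integrals over a set for the completed measure, as in the final
  statement, to whole-space integrals over \<open>lborel\<close>, where the estimates are carried
  out.\<close>

lemma lebesgue_set_integral_eq_lborel:
  fixes h :: "'a::euclidean_space \<Rightarrow> real"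
  assumes "(\<lambda>x. indicator S x * h x) \<in> borel_measurable lebesgue" "H \<in> borel_measurable borel"
    "AE x in lborel. indicator S x * h x = H x"
  shows "(LINT x:S|lebesgue. h x) = (\<integral>x. H x \<partial>lborel)"
proof -
  have "(LINT x:S|lebesgue. h x) = (\<integral>x. H x \<partial>lebesgue)"
    unfolding set_lebesgue_integral_def
    using assms AE_completion[OF assms(3)] by (intro integral_cong_AE) (auto simp: measurable_completion)
  also have "\<dots> = (\<integral>x. H x \<partial>lborel)"
    using assms(2) by (intro integral_completion) simp
  finally show ?thesis .
qed

text \<open>Both sides of the weak identity are integrals over the ball; as U and G vanish almost
  everywhere outside it, they become integrals over the whole space, insensitive to the choice of
  representatives.\<close>

lemma weak_gradient_representative:
  fixes u :: "'a::euclidean_space \<Rightarrow> real" and g :: "'a \<Rightarrow> 'a"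
  assumes grad: "has_L2_gradient (ball 0 r) u g"
    and u: "(\<lambda>x. if x \<in> ball 0 r then u x else 0) \<in> borel_measurable lebesgue"
    and g: "(\<lambda>x. if x \<in> ball 0 r then g x else 0) \<in> borel_measurable lebesgue"
    and U[measurable]: "U \<in> borel_measurable borel" and G[measurable]: "G \<in> borel_measurable borel"
    and uU: "AE x in lborel. (if x \<in> ball 0 r then u x else 0) = U x"
    and gG: "AE x in lborel. (if x \<in> ball 0 r then g x else 0) = G x"
  shows "weak_gradient (ball 0 r) U G"
  unfolding weak_gradient_def
proof (intro ballI)
  fix \<phi> :: "'a \<Rightarrow> real" and b :: 'a assume \<phi>: "\<phi> \<in> test_functions (ball 0 r)" and b: "b \<in> Basis"
  have "C_k (Suc 0) \<phi>" "C_k 0 \<phi>" using \<phi> by (auto simp only: test_functions_def mem_Collect_eq)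
  then have c1: "continuous_on UNIV (\<lambda>x. frechet_derivative \<phi> (at x) b)" and c0: "continuous_on UNIV \<phi>"
    using b by auto
  have [measurable]: "\<phi> \<in> borel_measurable borel" "(\<lambda>x. frechet_derivative \<phi> (at x) b) \<in> borel_measurable borel"
    by (auto intro!: borel_measurable_continuous_onI c0 c1)
  have "(LINT x|lebesgue_on (ball 0 r). u x * frechet_derivative \<phi> (at x) b)
      = (LINT x:ball 0 r|lebesgue. u x * frechet_derivative \<phi> (at x) b)"
    unfolding set_lebesgue_integral_def by (rule integral_restrict_space) simp
  also have "\<dots> = (\<integral>x. U x * frechet_derivative \<phi> (at x) b \<partial>lborel)"
  proof (rule lebesgue_set_integral_eq_lborel)
    have "(\<lambda>x. (if x \<in> ball 0 r then u x else 0) * frechet_derivative \<phi> (at x) b) \<in> borel_measurable lebesgue"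
      by (intro borel_measurable_times u measurable_completion) simp
    also have "(\<lambda>x. (if x \<in> ball 0 r then u x else 0) * frechet_derivative \<phi> (at x) b)
        = (\<lambda>x. indicator (ball 0 r) x * (u x * frechet_derivative \<phi> (at x) b))"
      by (auto simp: indicator_def)
    finally show "(\<lambda>x. indicator (ball 0 r) x * (u x * frechet_derivative \<phi> (at x) b)) \<in> borel_measurable lebesgue" .
    show "AE x in lborel. indicator (ball 0 r) x * (u x * frechet_derivative \<phi> (at x) b) = U x * frechet_derivative \<phi> (at x) b"
      using uU by eventually_elim (auto simp: indicator_def)
  qed simp
  finally have 1: "(LINT x|lebesgue_on (ball 0 r). u x * frechet_derivative \<phi> (at x) b) = (\<integral>x. U x * frechet_derivative \<phi> (at x) b \<partial>lborel)" .
  have "(LINT x|lebesgue_on (ball 0 r). (g x \<bullet> b) * \<phi> x) = (LINT x:ball 0 r|lebesgue. (g x \<bullet> b) * \<phi> x)"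
    unfolding set_lebesgue_integral_def by (rule integral_restrict_space) simp
  also have "\<dots> = (\<integral>x. (G x \<bullet> b) * \<phi> x \<partial>lborel)"
  proof (rule lebesgue_set_integral_eq_lborel)
    have "(\<lambda>x. ((if x \<in> ball 0 r then g x else 0) \<bullet> b) * \<phi> x) \<in> borel_measurable lebesgue"
      by (intro borel_measurable_times borel_measurable_inner g measurable_completion borel_measurable_const) simp
    also have "(\<lambda>x. ((if x \<in> ball 0 r then g x else 0) \<bullet> b) * \<phi> x) = (\<lambda>x. indicator (ball 0 r) x * ((g x \<bullet> b) * \<phi> x))"
      by (auto simp: indicator_def)
    finally show "(\<lambda>x. indicator (ball 0 r) x * ((g x \<bullet> b) * \<phi> x)) \<in> borel_measurable lebesgue" .
    show "AE x in lborel. indicator (ball 0 r) x * ((g x \<bullet> b) * \<phi> x) = (G x \<bullet> b) * \<phi> x"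
      using gG by eventually_elim (auto simp: indicator_def)
  qed simp
  finally have 2: "(LINT x|lebesgue_on (ball 0 r). (g x \<bullet> b) * \<phi> x) = (\<integral>x. (G x \<bullet> b) * \<phi> x \<partial>lborel)" .
  from grad \<phi> b have "(LINT x|lebesgue_on (ball 0 r). u x * frechet_derivative \<phi> (at x) b)
      = - (LINT x|lebesgue_on (ball 0 r). (g x \<bullet> b) * \<phi> x)"
    by (auto simp: has_L2_gradient_def)
  then show "(\<integral>y. U y * frechet_derivative \<phi> (at y) b \<partial>lborel) = - (\<integral>y. (G y \<bullet> b) * \<phi> y \<partial>lborel)"
    by (simp only: 1 2)
qed

text \<open>All integrals depend only on the classes of u and g modulo null sets, so both may be
  replaced by their Borel representatives.\<close>

lemma weighted_isoperimetric:
  fixes e :: "'a::euclidean_space"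
  assumes p: "p > -1" "e \<in> Basis" and eps: "0 < \<epsilon>" "\<epsilon> < min (1/2) (1 / (2 * (p + 1)))"
  shows "\<exists>C>0. \<forall>(k::real) (l::real) (r::real) (u :: 'a \<Rightarrow> real) (g :: 'a \<Rightarrow> 'a).
    k < l \<longrightarrow> r > 0 \<longrightarrow> u \<in> H1_on (ball 0 r) \<longrightarrow> has_L2_gradient (ball 0 r) u g \<longrightarrow>
      (l - k)
        * (LINT x:{x \<in> ball 0 r. u x \<ge> l}|lebesgue. \<bar>x \<bullet> e\<bar> powr p)
        * (LINT x:{x \<in> ball 0 r. u x \<le> k}|lebesgue. \<bar>x \<bullet> e\<bar> powr p)
      \<le> C * r powr (real DIM('a) + 2 * p + 1 + real DIM('a) * (1 - 2 * \<epsilon>) / 2 - \<epsilon> * p)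
        * (LINT x:{x \<in> ball 0 r. k < u x \<and> u x < l}|lebesgue. (norm (g x))\<^sup>2) powr (1/2)
        * (LINT x:{x \<in> ball 0 r. k < u x \<and> u x < l}|lebesgue. \<bar>x \<bullet> e\<bar> powr p) powr \<epsilon>"
proof -
  obtain C where C: "C > 0" "\<And>k l r (U :: 'a \<Rightarrow> real) (G :: 'a \<Rightarrow> 'a). k < l \<Longrightarrow> r > 0 \<Longrightarrow> integrable lborel U \<Longrightarrow> integrable lborel G \<Longrightarrow>
    integrable lborel (\<lambda>x. (norm (G x))\<^sup>2) \<Longrightarrow> (\<forall>x. x \<notin> ball 0 r \<longrightarrow> G x = 0) \<Longrightarrow> weak_gradient (ball 0 r) U G \<Longrightarrow>
      (l - k) * weighted_measure p e {x \<in> ball 0 r. U x \<ge> l} * weighted_measure p e {x \<in> ball 0 r. U x \<le> k}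
      \<le> C * r powr (real DIM('a) + 2 * p + 1 + real DIM('a) * (1 - 2 * \<epsilon>) / 2 - \<epsilon> * p)
        * (\<integral>x. indicator {x \<in> ball 0 r. k < U x \<and> U x < l} x * (norm (G x))\<^sup>2 \<partial>lborel) powr (1/2)
        * weighted_measure p e {x \<in> ball 0 r. k < U x \<and> U x < l} powr \<epsilon>"
    using weighted_isoperimetric_borel[OF p eps] by blast
  have "(l - k)
        * (LINT x:{x \<in> ball 0 r. u x \<ge> l}|lebesgue. \<bar>x \<bullet> e\<bar> powr p)
        * (LINT x:{x \<in> ball 0 r. u x \<le> k}|lebesgue. \<bar>x \<bullet> e\<bar> powr p)
      \<le> C * r powr (real DIM('a) + 2 * p + 1 + real DIM('a) * (1 - 2 * \<epsilon>) / 2 - \<epsilon> * p)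
        * (LINT x:{x \<in> ball 0 r. k < u x \<and> u x < l}|lebesgue. (norm (g x))\<^sup>2) powr (1/2)
        * (LINT x:{x \<in> ball 0 r. k < u x \<and> u x < l}|lebesgue. \<bar>x \<bullet> e\<bar> powr p) powr \<epsilon>"
    if kl: "k < l" and r: "r > 0" and uH: "u \<in> H1_on (ball 0 r)" and grad: "has_L2_gradient (ball 0 r) u g"
    for k l r :: real and u :: "'a \<Rightarrow> real" and g :: "'a \<Rightarrow> 'a"
  proof -
    have u2: "u \<in> L2_on (ball 0 r)" and g2: "g \<in> L2_on (ball 0 r)"
      using uH grad by (auto simp: H1_on_def has_L2_gradient_def)
    define u0 where "u0 x = (if x \<in> ball 0 r then u x else 0)" for x
    define g0 where "g0 x = (if x \<in> ball 0 r then g x else 0)" for x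
    have u0[measurable]: "u0 \<in> borel_measurable lebesgue" and g0[measurable]: "g0 \<in> borel_measurable lebesgue"
      unfolding u0_def[abs_def] g0_def[abs_def] by (rule L2_on_ball_measurable[OF u2], rule L2_on_ball_measurable[OF g2])
    obtain U where U[measurable]: "U \<in> borel_measurable borel" "AE x in lborel. u0 x = U x" "integrable lborel U"
      using L2_on_ball_borel_representative[OF u2] unfolding u0_def by blast
    obtain G where G[measurable]: "G \<in> borel_measurable borel" "AE x in lborel. g0 x = G x"
      "integrable lborel G" "integrable lborel (\<lambda>x. (norm (G x))\<^sup>2)" "\<And>x. x \<notin> ball 0 r \<Longrightarrow> G x = 0"
      using L2_on_ball_borel_representative[OF g2] unfolding g0_def by blast
    have weak: "weak_gradient (ball 0 r) U G"
      by (rule weak_gradient_representative[OF grad]) (use u0 g0 U G in \<open>simp_all add: u0_def[abs_def] g0_def[abs_def]\<close>)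
    have w[measurable]: "(\<lambda>x. \<bar>x \<bullet> e\<bar> powr p) \<in> borel_measurable lebesgue"
      by (rule measurable_completion) simp
    have wm: "(LINT x:{x \<in> ball 0 r. P (u x)}|lebesgue. \<bar>x \<bullet> e\<bar> powr p) = weighted_measure p e {x \<in> ball 0 r. P (U x)}"
      if [measurable]: "Measurable.pred borel P" for P
      unfolding weighted_measure_def
    proof (rule lebesgue_set_integral_eq_lborel)
      \<comment> \<open>The ball indicator has to stay: \<open>u0\<close> is 0 outside the ball, and
        P may hold at 0.\<close>
      have "(\<lambda>x. indicator (ball 0 r) x * (indicator {s. P s} (u0 x) * \<bar>x \<bullet> e\<bar> powr p)) \<in> borel_measurable lebesgue"
        by (intro borel_measurable_times w borel_measurable_indicator) (simp, measurable)
      also have "(\<lambda>x. indicator (ball 0 r) x * (indicator {s. P s} (u0 x) * \<bar>x \<bullet> e\<bar> powr p))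
          = (\<lambda>x. indicator {x \<in> ball 0 r. P (u x)} x * \<bar>x \<bullet> e\<bar> powr p)"
        by (auto simp: indicator_def u0_def)
      finally show "(\<lambda>x. indicator {x \<in> ball 0 r. P (u x)} x * \<bar>x \<bullet> e\<bar> powr p) \<in> borel_measurable lebesgue" .
      show "AE x in lborel. indicator {x \<in> ball 0 r. P (u x)} x * \<bar>x \<bullet> e\<bar> powr p = indicator {x \<in> ball 0 r. P (U x)} x * \<bar>x \<bullet> e\<bar> powr p"
        using U(2) by eventually_elim (auto simp: indicator_def u0_def)
    qed measurable
    have grad_eq: "(LINT x:{x \<in> ball 0 r. k < u x \<and> u x < l}|lebesgue. (norm (g x))\<^sup>2)
        = (\<integral>x. indicator {x \<in> ball 0 r. k < U x \<and> U x < l} x * (norm (G x))\<^sup>2 \<partial>lborel)"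
    proof (rule lebesgue_set_integral_eq_lborel)
      \<comment> \<open>No ball indicator is needed here, since \<open>g0\<close> already vanishes
        outside the ball.\<close>
      have "(\<lambda>x. indicator {k<..<l} (u0 x) * (norm (g0 x))\<^sup>2) \<in> borel_measurable lebesgue"
        by measurable
      also have "(\<lambda>x. indicator {k<..<l} (u0 x) * (norm (g0 x))\<^sup>2)
          = (\<lambda>x. indicator {x \<in> ball 0 r. k < u x \<and> u x < l} x * (norm (g x))\<^sup>2)"
        by (auto simp: indicator_def u0_def g0_def)
      finally show "(\<lambda>x. indicator {x \<in> ball 0 r. k < u x \<and> u x < l} x * (norm (g x))\<^sup>2) \<in> borel_measurable lebesgue" .
      show "AE x in lborel. indicator {x \<in> ball 0 r. k < u x \<and> u x < l} x * (norm (g x))\<^sup>2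
          = indicator {x \<in> ball 0 r. k < U x \<and> U x < l} x * (norm (G x))\<^sup>2"
        using U(2) G(2) by eventually_elim (auto simp: indicator_def u0_def g0_def split: if_splits)
    qed measurable
    have wA: "(LINT x:{x \<in> ball 0 r. u x \<ge> l}|lebesgue. \<bar>x \<bullet> e\<bar> powr p) = weighted_measure p e {x \<in> ball 0 r. U x \<ge> l}"
      by (rule wm) measurable
    have wB: "(LINT x:{x \<in> ball 0 r. u x \<le> k}|lebesgue. \<bar>x \<bullet> e\<bar> powr p) = weighted_measure p e {x \<in> ball 0 r. U x \<le> k}"
      by (rule wm) measurable
    have wD: "(LINT x:{x \<in> ball 0 r. k < u x \<and> u x < l}|lebesgue. \<bar>x \<bullet> e\<bar> powr p)
        = weighted_measure p e {x \<in> ball 0 r. k < U x \<and> U x < l}"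
      by (rule wm[of "\<lambda>s. k < s \<and> s < l"]) measurable
    show ?thesis
      unfolding wA wB wD grad_eq using C(2)[OF kl r U(3) G(3,4) _ weak] G(5) by blast
  qed
  with C(1) show ?thesis by blast
qed

text \<open>C is chosen before k, l, r, u and g, which expresses its dependence on n, p and
  \<epsilon> alone; g ranges over all versions of the weak gradient.\<close>

theorem theorem2p12:
  fixes p \<epsilon> :: real
  assumes "p > -1"
    and "0 < \<epsilon>" and "\<epsilon> < min (1/2) (1 / (2 * (p + 1)))"
  shows "\<exists>C>0. \<forall>(k::real) (l::real) (r::real)
      (u :: real ^ ('n::{finite,linorder}) \<Rightarrow> real) (g :: real ^ ('n::{finite,linorder}) \<Rightarrow> real ^ ('n::{finite,linorder})).
    k < l \<longrightarrow> r > 0 \<longrightarrow> u \<in> H1_on (ball 0 r) \<longrightarrow> has_L2_gradient (ball 0 r) u g \<longrightarrow>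
      (l - k)
        * (LINT x:{x \<in> ball 0 r. u x \<ge> l}|lebesgue. \<bar>last_coord x\<bar> powr p)
        * (LINT x:{x \<in> ball 0 r. u x \<le> k}|lebesgue. \<bar>last_coord x\<bar> powr p)
      \<le> C * r powr (real CARD('n) + 2 * p + 1 + real CARD('n) * (1 - 2 * \<epsilon>) / 2 - \<epsilon> * p)
        * (LINT x:{x \<in> ball 0 r. k < u x \<and> u x < l}|lebesgue. (norm (g x))\<^sup>2) powr (1/2)
        * (LINT x:{x \<in> ball 0 r. k < u x \<and> u x < l}|lebesgue. \<bar>last_coord x\<bar> powr p) powr \<epsilon>"
proof -
  \<comment> \<open>The last coordinate is the inner product with this basis vector, so the version
    for an arbitrary basis vector applies.\<close>
  have e: "axis (Max UNIV) 1 \<in> (Basis :: (real ^ ('n::{finite,linorder})) set)"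
    by (simp add: axis_in_Basis_iff)
  have lc: "x \<bullet> axis (Max UNIV) 1 = last_coord x" for x :: "real ^ ('n::{finite,linorder})"
    by (simp add: last_coord_def inner_axis)
  show ?thesis
    using weighted_isoperimetric[OF assms(1) e assms(2,3)] unfolding lc by simp
qed

end
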